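(* Let $k$ be a field, let $S$ be the homogeneous coordinate algebra of a weighted projective line of tubular type with weight sequence $\mathbf{p}$, and let $R$ be the associated $\mathbb{Z}$-graded algebra of the same type. Let $H=H(\mathbf{p})=\mathbb{Z}(3\vec x_1)\oplus\mathbb{Z}\vec\omega\subseteq L(\mathbf{p})$, let $S_H=\bigoplus_{\vec x\in H}S_{\vec x}$, and let $x,y,z\in S_H$ be the homogeneous elements specified in the context according to the type. Let $\pi\colon H\to\mathbb{Z}$ be the surjective homomorphism with $\pi(3\vec x_1)=1$ and $\pi(\vec\omega)=0$. Then $k[x,y,z]=S_H$, where $k[x,y,z]$ denotes the subalgebra of $S$ generated by $x,y,z$, and there is an isomorphism of $\mathbb{Z}$-graded algebras $R\simeq\pi_*(S_H)$.
   Context: String group. For a weight sequence $\mathbf{p}=(p_1,\dots,p_t)$ (integers $p_i\ge2$, $p_1\ge\cdots\ge p_t$), $L(\mathbf{p})$ is the abelian group with generators $\vec x_1,\dots,\vec x_t$ and relations $p_1\vec x_1=\cdots=p_t\vec x_t=:\vec c$. The dualizing element is $\vec\omega=(t-2)\vec c-\sum_{i=1}^t\vec x_i$. The weight sequence is of tubular type if $\vec\omega$ is torsion; the tubular weight sequences are exactly $(2,2,2,2)$, $(3,3,3)$, $(4,4,2)$, $(6,3,2)$, and in each case $\vec\omega$ has order $p=\mathrm{lcm}(\mathbf{p})=p_1$. $H(\mathbf{p})$ is the subgroup of $L(\mathbf{p})$ generated by $3\vec x_1$ and $\vec\omega$; it is the direct sum $\mathbb{Z}(3\vec x_1)\oplus\mathbb{Z}\vec\omega$.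 The algebras. The $L(\mathbf{p})$-graded algebra $S$ (with $\deg X_i=\vec x_i$; $x_i$ denotes the class of $X_i$ in $S$), the $\mathbb{Z}$-graded algebra $R$ (with $X,Y,Z$ of degree $1$), and the elements $x,y,z\in S$ are: - type $(2,2,2,2;\lambda)$ with $\lambda\in k\setminus\{0,1\}$: $S=k[X_1,X_2,X_3,X_4]/(X_3^2-(X_2^2-X_1^2),\,X_4^2-(X_2^2-\lambda X_1^2))$, $R=k[X,Y,Z]/(Y^2Z-X(X-Z)(X-\lambda Z))$; $x=x_1x_2^2,\ y=x_2x_3x_4,\ z=x_1^3$; - type $(3,3,3)$: $S=k[X_1,X_2,X_3]/(X_3^3-(X_2^3-X_1^3))$, $R=k[X,Y,Z]/(X^3-(Y^2Z-Z^2Y))$; $x=x_1x_2x_3,\ y=x_2^3,\ z=x_1^3$; - type $(4,4,2)$: $S=k[X_1,X_2,X_3]/(X_3^2-(X_2^4-X_1^4))$, $R=k[X,Y,Z]/(Y^2Z-X(X-Z)(X+Z))$; $x=x_1x_2^2,\ y=x_2x_3,\ z=x_1^3$; - type $(6,3,2)$: $S=k[X_1,X_2,X_3]/(X_3^2-(X_2^3-X_1^6))$, $R=k[X,Y,Z]/(Y^2Z-(X^3-Z^3))$; $x=x_1x_2,\ y=x_3,\ z=x_1^3$. In all cases the degrees of $x,y,z$ lie in $3\vec x_1+\mathbb{Z}\vec\omega\subseteq H$. Push-forward of gradings. For a homomorphism $\pi\colon G\to G'$ of groups and a $G$-graded ring $A$, $\pi_*(A)$ is the $G'$-graded ring equal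 to $A$ as a ring, with homogeneous components $\pi_*(A)_{h}=\bigoplus_{g\in\pi^{-1}(h)}A_g$ for $h\in G'$. *)

theory Defs
  imports "HOL-Algebra.Algebra" "HOL-Library.Poly_Mapping"
begin

section \<open>Group-graded algebras\<close>

text \<open>
  An algebra over a field (a type of class \<open>field\<close>) together with the family of its homogeneous
  components.  If the grading group is given by a record \<open>G\<close>, only the components
  \<open>homog A g\<close> with \<open>g \<in> carrier G\<close> are meaningful.
\<close>

record ('k, 'b, 'g) graded_alg = "('k, 'b) module" +
  homog :: "'g \<Rightarrow> 'b set"

text \<open>The sum inside \<open>A\<close> of the components with degree in \<open>J\<close>.\<close>

definition homog_sum :: "('k, 'b, 'g) graded_alg \<Rightarrow> 'g set \<Rightarrow> 'b set" where
  "homog_sum A J =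
     {finsum A f F | f F. finite F \<and> F \<subseteq> J \<and> (\<forall>g\<in>F. f g \<in> homog A g)}"

definition restrict_grading :: "('k, 'b, 'g) graded_alg \<Rightarrow> 'g set \<Rightarrow> ('k, 'b, 'g) graded_alg" where
  "restrict_grading A J = A\<lparr>carrier := homog_sum A J\<rparr>"

text \<open>The push-forward of a \<open>G\<close>-grading; the underlying algebra is unchanged.\<close>

definition pushforward ::
  "('g, 'm) monoid_scheme \<Rightarrow> ('g \<Rightarrow> 'h) \<Rightarrow> ('k, 'b, 'g) graded_alg \<Rightarrow> ('k, 'b, 'h) graded_alg" where
  "pushforward G \<pi> A =
     \<lparr>carrier = carrier A, monoid.mult = monoid.mult A, monoid.one = monoid.one A, ring.zero = ring.zero A, ring.add = ring.add A,
      smult = smult A, homog = (\<lambda>h. homog_sum A {g \<in> carrier G. \<pi> g = h})\<rparr>"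

definition graded_alg_iso ::
  "('k, 'b, 'g) graded_alg \<Rightarrow> ('k, 'c, 'g) graded_alg \<Rightarrow> ('b \<Rightarrow> 'c) set" where
  "graded_alg_iso A B =
     {\<phi> \<in> ring_iso A B.
        (\<forall>c. \<forall>a\<in>carrier A. \<phi> (c \<odot>\<^bsub>A\<^esub> a) = c \<odot>\<^bsub>B\<^esub> \<phi> a) \<and>
        (\<forall>g. \<phi> ` homog A g = homog B g)}"

definition generated_subalgebra :: "('k, 'b, 'g) graded_alg \<Rightarrow> 'b set \<Rightarrow> 'b set" where
  "generated_subalgebra A E =
     \<Inter>{B. subring B A \<and> (\<forall>c. \<forall>b\<in>B. c \<odot>\<^bsub>A\<^esub> b \<in> B) \<and> E \<subseteq> B}"


section \<open>Polynomials in finitely many variables and their graded quotients\<close>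

text \<open>
  Polynomials with variables indexed by the natural numbers; \<open>k[X\<^sub>1,\<dots>,X\<^sub>n]\<close> is the set of those
  that only involve variables with index in \<open>{1..n}\<close>.
\<close>

type_synonym exponent = "nat \<Rightarrow>\<^sub>0 nat"
type_synonym 'k mpoly = "exponent \<Rightarrow>\<^sub>0 'k"

definition Var :: "nat \<Rightarrow> 'k::field mpoly" where
  "Var i = Poly_Mapping.single (Poly_Mapping.single i 1) 1"

definition Const :: "'k::field \<Rightarrow> 'k mpoly" where
  "Const c = Poly_Mapping.single 0 c"

definition poly_alg :: "nat \<Rightarrow> ('k::field, 'k mpoly) module" where
  "poly_alg n =
     \<lparr>carrier = {f. \<forall>m\<in>Poly_Mapping.keys f. Poly_Mapping.keys m \<subseteq> {1..n}},
      monoid.mult = (*), monoid.one = 1, ring.zero = 0, ring.add = (+), smult = (\<lambda>c f. Const c * f)\<rparr>"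

text \<open>
  The quotient of \<open>k[X\<^sub>1,\<dots>,X\<^sub>n]\<close> by the ideal generated by \<open>E\<close>, where \<open>X\<^sup>m\<close> has degree \<open>d m\<close>.
  On a coset \<open>a\<close>, the union that defines \<open>c \<odot> a\<close> ranges over equal cosets.
\<close>

definition graded_quotient ::
  "nat \<Rightarrow> (exponent \<Rightarrow> 'g) \<Rightarrow> 'k::field mpoly set \<Rightarrow> ('k, 'k mpoly set, 'g) graded_alg" where
  "graded_quotient n d E =
     (let P = poly_alg n; I = Idl\<^bsub>P\<^esub> E; Q = P Quot I in
      \<lparr>carrier = carrier Q, monoid.mult = monoid.mult Q, monoid.one = monoid.one Q, ring.zero = ring.zero Q, ring.add = ring.add Q,
       smult = (\<lambda>c a. \<Union>f\<in>a. I +>\<^bsub>P\<^esub> (c \<odot>\<^bsub>P\<^esub> f)),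
       homog = (\<lambda>g. (\<lambda>f. I +>\<^bsub>P\<^esub> f) ` {f \<in> carrier P. \<forall>m\<in>Poly_Mapping.keys f. d m = g})\<rparr>)"


section \<open>The string group\<close>

text \<open>
  A weight sequence \<open>(p\<^sub>1,\<dots>,p\<^sub>t)\<close> is a list, so that \<open>p\<^sub>i = p ! (i - 1)\<close>.  The abelian group
  \<open>L(p)\<close> is written multiplicatively, following the group records of the library, and its
  elements are cosets in the free abelian group on \<open>{1..t}\<close>.
\<close>

definition weight :: "nat list \<Rightarrow> nat \<Rightarrow> nat" where
  "weight p i = p ! (i - 1)"

definition string_relations :: "nat list \<Rightarrow> (nat \<Rightarrow>\<^sub>0 int) set" where
  "string_relations p =
     generate (free_Abelian_group {1..length p})
       {frag_cmul (int (weight p i)) (frag_of i) - frag_cmul (int (weight p j)) (frag_of j) | i j.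
          i \<in> {1..length p} \<and> j \<in> {1..length p}}"

definition string_group :: "nat list \<Rightarrow> (nat \<Rightarrow>\<^sub>0 int) set monoid" where
  "string_group p = free_Abelian_group {1..length p} Mod string_relations p"

definition xvec :: "nat list \<Rightarrow> nat \<Rightarrow> (nat \<Rightarrow>\<^sub>0 int) set" where
  "xvec p i = string_relations p #>\<^bsub>free_Abelian_group {1..length p}\<^esub> frag_of i"

definition cvec :: "nat list \<Rightarrow> (nat \<Rightarrow>\<^sub>0 int) set" where
  "cvec p = xvec p 1 [^]\<^bsub>string_group p\<^esub> weight p 1"

definition omega :: "nat list \<Rightarrow> (nat \<Rightarrow>\<^sub>0 int) set" where
  "omega p =
     cvec p [^]\<^bsub>string_group p\<^esub> (int (length p) - 2)
       \<otimes>\<^bsub>string_group p\<^esub> inv\<^bsub>string_group p\<^esub> finprod (string_group p) (xvec p) {1..length p}"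

definition H_group :: "nat list \<Rightarrow> (nat \<Rightarrow>\<^sub>0 int) set monoid" where
  "H_group p =
     subgroup_generated (string_group p) {xvec p 1 [^]\<^bsub>string_group p\<^esub> (3::nat), omega p}"

text \<open>The degree of \<open>X\<^sup>m\<close> when \<open>X\<^sub>i\<close> has degree \<open>xvec p i\<close>.\<close>

definition string_degree :: "nat list \<Rightarrow> exponent \<Rightarrow> (nat \<Rightarrow>\<^sub>0 int) set" where
  "string_degree p m =
     finprod (string_group p)
       (\<lambda>i. xvec p i [^]\<^bsub>string_group p\<^esub> Poly_Mapping.lookup m i) {1..length p}"


section \<open>The algebras of tubular type\<close>

datatype 'k tubular_type = T2222 'k | T333 | T442 | T632

fun admissible :: "'k::field tubular_type \<Rightarrow> bool" where
  "admissible (T2222 l) \<longleftrightarrow> l \<noteq> 0 \<and> l \<noteq> 1"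
| "admissible _ \<longleftrightarrow> True"

fun weights :: "'k tubular_type \<Rightarrow> nat list" where
  "weights (T2222 _) = [2, 2, 2, 2]"
| "weights T333 = [3, 3, 3]"
| "weights T442 = [4, 4, 2]"
| "weights T632 = [6, 3, 2]"

fun S_relations :: "'k::field tubular_type \<Rightarrow> 'k mpoly set" where
  "S_relations (T2222 l) =
     {Var 3 ^ 2 - (Var 2 ^ 2 - Var 1 ^ 2), Var 4 ^ 2 - (Var 2 ^ 2 - Const l * Var 1 ^ 2)}"
| "S_relations T333 = {Var 3 ^ 3 - (Var 2 ^ 3 - Var 1 ^ 3)}"
| "S_relations T442 = {Var 3 ^ 2 - (Var 2 ^ 4 - Var 1 ^ 4)}"
| "S_relations T632 = {Var 3 ^ 2 - (Var 2 ^ 3 - Var 1 ^ 6)}"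

definition S_alg ::
  "'k::field tubular_type \<Rightarrow> ('k, 'k mpoly set, (nat \<Rightarrow>\<^sub>0 int) set) graded_alg" where
  "S_alg T =
     graded_quotient (length (weights T)) (string_degree (weights T)) (S_relations T)"

definition S_gen :: "'k::field tubular_type \<Rightarrow> nat \<Rightarrow> 'k mpoly set" where
  "S_gen T i =
     (let P = poly_alg (length (weights T)) in (Idl\<^bsub>P\<^esub> S_relations T) +>\<^bsub>P\<^esub> Var i)"

text \<open>The variables \<open>X, Y, Z\<close> of \<open>R\<close> are \<open>Var 1, Var 2, Var 3\<close>.\<close>

fun R_relation :: "'k::field tubular_type \<Rightarrow> 'k mpoly" where
  "R_relation (T2222 l) =
     Var 2 ^ 2 * Var 3 - Var 1 * (Var 1 - Var 3) * (Var 1 - Const l * Var 3)"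
| "R_relation T333 = Var 1 ^ 3 - (Var 2 ^ 2 * Var 3 - Var 3 ^ 2 * Var 2)"
| "R_relation T442 = Var 2 ^ 2 * Var 3 - Var 1 * (Var 1 - Var 3) * (Var 1 + Var 3)"
| "R_relation T632 = Var 2 ^ 2 * Var 3 - (Var 1 ^ 3 - Var 3 ^ 3)"

definition R_alg :: "'k::field tubular_type \<Rightarrow> ('k, 'k mpoly set, int) graded_alg" where
  "R_alg T = graded_quotient 3 (\<lambda>m. \<Sum>i\<in>{1..3}. int (Poly_Mapping.lookup m i)) {R_relation T}"

context
  fixes T :: "'k::field tubular_type"
begin

private abbreviation S_mult (infixl \<open>\<cdot>\<close> 70) where "a \<cdot> b \<equiv> a \<otimes>\<^bsub>S_alg T\<^esub> b"
private abbreviation S_pow (infixr \<open>\<up>\<close> 75) where "a \<up> (n::nat) \<equiv> a [^]\<^bsub>S_alg T\<^esub> n"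
private abbreviation "\<xi> \<equiv> S_gen T"

definition elem_x :: "'k mpoly set" where
  "elem_x = (case T of
       T2222 _ \<Rightarrow> \<xi> 1 \<cdot> \<xi> 2 \<up> 2
     | T333 \<Rightarrow> \<xi> 1 \<cdot> \<xi> 2 \<cdot> \<xi> 3
     | T442 \<Rightarrow> \<xi> 1 \<cdot> \<xi> 2 \<up> 2
     | T632 \<Rightarrow> \<xi> 1 \<cdot> \<xi> 2)"

definition elem_y :: "'k mpoly set" where
  "elem_y = (case T of
       T2222 _ \<Rightarrow> \<xi> 2 \<cdot> \<xi> 3 \<cdot> \<xi> 4
     | T333 \<Rightarrow> \<xi> 2 \<up> 3
     | T442 \<Rightarrow> \<xi> 2 \<cdot> \<xi> 3
     | T632 \<Rightarrow> \<xi> 3)"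

definition elem_z :: "'k mpoly set" where
  "elem_z = \<xi> 1 \<up> 3"

end

definition S_H :: "'k::field tubular_type \<Rightarrow> ('k, 'k mpoly set, (nat \<Rightarrow>\<^sub>0 int) set) graded_alg" where
  "S_H T = restrict_grading (S_alg T) (carrier (H_group (weights T)))"

end

theory Submission
  imports Defs
begin

text \<open>
  In every type the relations of \<open>S\<close> are \<open>X\<^sub>i\<^bsup>p\<^sub>i\<^esup> = X\<^sub>2\<^bsup>p\<^sub>2\<^esup> - \<lambda>\<^sub>i X\<^sub>1\<^bsup>p\<^sub>1\<^esup>\<close> for \<open>i \<ge> 3\<close>.  Replacing
  powers of \<open>X\<^sub>i\<close> accordingly gives a linear normal form map on \<open>k[X\<^sub>1,\<dots>,X\<^sub>t]\<close> whose kernel is the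
  ideal of relations; it sends a monomial to another monomial (the leading one) plus terms of smaller
  degree in \<open>X\<^sub>2\<close>.  Since \<open>x\<close>, \<open>y\<close>, \<open>z\<close> are monomials, \<open>X \<mapsto> x\<close>, \<open>Y \<mapsto> y\<close>, \<open>Z \<mapsto> z\<close> maps monomials
  to monomials.  The relation of \<open>R\<close> is monic of degree 3 in \<open>X\<close> up to sign, so \<open>R\<close> is spanned by the
  monomials of degree at most 2 in \<open>X\<close>, and the leading monomials of their images are pairwise
  distinct and are exactly the normal monomials of \<open>S\<close> with degree in \<open>H\<close>.  Triangularity with
  respect to the degree in \<open>X\<^sub>2\<close> then gives injectivity and surjectivity onto \<open>S\<^sub>H\<close> at once.
\<close>

section \<open>Monomials and linear extension\<close>

text \<open>Bases of \<open>R\<close> and \<open>S\<close> cannot be matched monomial by monomial: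
  outside type (3,3,3) the element y contains X_3, so already y^2 has to be reduced. This is why
  leading terms are compared. The degree in X_2 is a good measure because a reduction puts X_2^{p_2}
  minus a multiple of X_1^{p_1} in place of X_i^{p_i}: a lower term differs from the leading one
  only by trading blocks X_2^{p_2} for X_1^{p_1}. As p_1 x_1 = p_2 x_2 in L(p), such a trade changes
  neither the degree nor the exponents of X_3 and X_4, so the lower terms of a normal form with
  degree in H are again normal monomials with degree in H, and induction applies to them. The bound
  2 on the degree in X is forced: X^aY^bZ^c has X_1-exponent a + 3c in its leading image, which
  gives a only modulo 3, and the leading images of X^3 and Y^2 Z agree in every type. What remains
  is arithmetic, once membership in H is expressed by divisibility of exponents.\<close>

abbreviation mon :: "exponent \<Rightarrow> 'k::field mpoly" where
  "mon m \<equiv> Poly_Mapping.single m 1"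

definition linext :: "(exponent \<Rightarrow> 'k mpoly) \<Rightarrow> 'k mpoly \<Rightarrow> 'k::field mpoly" where
  "linext F f = (\<Sum>m\<in>Poly_Mapping.keys f. Const (Poly_Mapping.lookup f m) * F m)"

lemma Const_0 [simp]: "Const 0 = 0"
  and Const_1 [simp]: "Const 1 = 1"
  and Const_add: "Const (a + b) = Const a + Const b"
  and Const_uminus: "Const (- a) = - Const a"
  and Const_mult: "Const (a * b) = Const a * Const b"
  by (simp_all add: Const_def single_add single_uminus mult_single)

lemma Const_mult_mon: "Const c * mon m = Poly_Mapping.single m c"
  by (simp add: Const_def mult_single)

lemma mon_add: "mon (m + n) = mon m * mon n"
  by (simp add: mult_single)

lemma mon_single_power: "mon (Poly_Mapping.single i a) ^ b = mon (Poly_Mapping.single i (a * b))"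
  by (induction b) (simp_all flip: mon_add single_add add: add.commute)

lemma mon_sum: "finite J \<Longrightarrow> mon (sum f J) = (\<Prod>i\<in>J. mon (f i))"
  by (induction J rule: finite_induct) (simp_all add: mon_add)

lemma Var_power: "Var i ^ a = mon (Poly_Mapping.single i a)"
  by (simp add: Var_def mon_single_power)

lemma lookup_Const_mult [simp]: "Poly_Mapping.lookup (Const c * f) m = c * Poly_Mapping.lookup f m"
  by (simp add: Const_def mult_map_scale_conv_mult[symmetric] Poly_Mapping.map.rep_eq when_def)

lemma keys_Const_mult: "Poly_Mapping.keys (Const c * f) \<subseteq> Poly_Mapping.keys f"
  by (auto simp: in_keys_iff)

lemma exponent_eqI:
  assumes "Poly_Mapping.keys m \<subseteq> {1..n}" "Poly_Mapping.keys m' \<subseteq> {1..n}"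
    and "\<And>i. i \<in> {1..n} \<Longrightarrow> Poly_Mapping.lookup m i = Poly_Mapping.lookup m' i"
  shows "m = (m' :: exponent)"
proof (rule poly_mapping_eqI)
  fix i
  show "Poly_Mapping.lookup m i = Poly_Mapping.lookup m' i"
  proof (cases "i \<in> {1..n}")
    case False
    then have "i \<notin> Poly_Mapping.keys m" "i \<notin> Poly_Mapping.keys m'"
      using assms(1,2) by blast+
    then show ?thesis by (simp add: in_keys_iff)
  qed (rule assms(3))
qed

lemma keys_diff_subset:
  fixes f g :: "'a \<Rightarrow>\<^sub>0 'b::ab_group_add"
  shows "Poly_Mapping.keys (f - g) \<subseteq> Poly_Mapping.keys f \<union> Poly_Mapping.keys g"
  by (auto simp: in_keys_iff lookup_minus)

lemma mpoly_expansion: "f = (\<Sum>m\<in>Poly_Mapping.keys f. Poly_Mapping.single m (Poly_Mapping.lookup f m))"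
  by (rule poly_mapping_eqI) (simp add: lookup_sum lookup_single when_def in_keys_iff)

text \<open>A polynomial is the sum of its terms, so linearity suffices. The set \<open>M\<close> is
  a parameter because later inductions have to remember exponent bounds or degrees of the monomials
  that occur.\<close>

lemma mpoly_induct [consumes 1, case_names zero mon add scale]:
  assumes "Poly_Mapping.keys f \<subseteq> M"
    and "Q 0" "\<And>m. m \<in> M \<Longrightarrow> Q (mon m)"
    and "\<And>f g. Q f \<Longrightarrow> Q g \<Longrightarrow> Q (f + g)" "\<And>c f. Q f \<Longrightarrow> Q (Const c * f)"
  shows "Q f"
proof -
  have "Q (Poly_Mapping.single m c)" if "m \<in> M" for m c
    using assms(3)[OF that] assms(5) by (metis Const_mult_mon)
  note single = this
  have "Q (\<Sum>m\<in>F. Poly_Mapping.single m (Poly_Mapping.lookup f m))" if "finite F" "F \<subseteq> M" for F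
    using that by (induction rule: finite_induct) (simp_all add: assms(2,4) single)
  from this[OF finite_keys assms(1)] show ?thesis
    by (simp flip: mpoly_expansion)
qed

lemma linext_superset:
  assumes "finite F" "Poly_Mapping.keys f \<subseteq> F"
  shows "linext G f = (\<Sum>m\<in>F. Const (Poly_Mapping.lookup f m) * G m)"
  unfolding linext_def using assms
  by (intro sum.mono_neutral_left) (auto simp: in_keys_iff)

lemma linext_0 [simp]: "linext G 0 = 0"
  by (simp add: linext_def)

lemma linext_mon [simp]: "linext G (mon m) = G m"
  by (simp add: linext_def)

lemma linext_add: "linext G (f + g) = linext G f + linext G g"
proof -
  let ?F = "Poly_Mapping.keys f \<union> Poly_Mapping.keys g"
  have "linext G h = (\<Sum>m\<in>?F. Const (Poly_Mapping.lookup h m) * G m)"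
    if "h = f \<or> h = g \<or> h = f + g" for h
    using that Poly_Mapping.keys_add[of f g] by (intro linext_superset) auto
  then show ?thesis
    by (simp add: lookup_add Const_add distrib_right sum.distrib)
qed

lemma linext_Const_mult: "linext G (Const c * f) = Const c * linext G f"
  by (subst linext_superset[OF finite_keys keys_Const_mult])
    (simp add: linext_def sum_distrib_left Const_mult mult.assoc)

lemma linext_uminus: "linext G (- f) = - linext G f"
  using linext_Const_mult[of G "- 1" f] by (simp add: Const_uminus)

lemma linext_diff: "linext G (f - g) = linext G f - linext G g"
  using linext_add[of G f "- g"] by (simp add: linext_uminus)

lemma linext_mult:
  assumes "\<And>m n. G (m + n) = G m * G n"
  shows "linext G (f * g) = linext G f * linext G g"
proof -
  have mon: "linext G (mon m * g) = G m * linext G g" for m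
    using subset_UNIV
    by (induction g rule: mpoly_induct)
      (simp_all add: linext_add linext_Const_mult distrib_left mult.left_commute assms
        flip: mon_add)
  show ?thesis
    using subset_UNIV
    by (induction f rule: mpoly_induct)
      (simp_all add: mon linext_add linext_Const_mult distrib_right mult.assoc)
qed

lemma keys_linext:
  "Poly_Mapping.keys (linext G f) \<subseteq> (\<Union>m\<in>Poly_Mapping.keys f. Poly_Mapping.keys (G m))"
  unfolding linext_def using keys_sum[of _ "Poly_Mapping.keys f"] keys_Const_mult by fastforce

section \<open>Polynomial algebras and their graded quotients\<close>

lemma carrier_poly_alg:
  "f \<in> carrier (poly_alg n) \<longleftrightarrow>
    Poly_Mapping.keys f \<subseteq> {m. Poly_Mapping.keys m \<subseteq> {1..n}}"
  by (auto simp: poly_alg_def)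

lemma poly_alg_ops [simp]:
  "f \<otimes>\<^bsub>poly_alg n\<^esub> g = f * g" "f \<oplus>\<^bsub>poly_alg n\<^esub> g = f + g"
  "\<one>\<^bsub>poly_alg n\<^esub> = 1" "\<zero>\<^bsub>poly_alg n\<^esub> = 0" "c \<odot>\<^bsub>poly_alg n\<^esub> f = Const c * f"
  by (simp_all add: poly_alg_def)

lemma mon_in_poly_alg [simp]: "mon m \<in> carrier (poly_alg n) \<longleftrightarrow> Poly_Mapping.keys m \<subseteq> {1..n}"
  by (simp add: carrier_poly_alg)

lemma poly_alg_closed [simp, intro]:
  fixes f g :: "'k::field mpoly"
  shows "0 \<in> carrier (poly_alg n)" "1 \<in> carrier (poly_alg n)" "Const c \<in> carrier (poly_alg n)"
    and "f \<in> carrier (poly_alg n) \<Longrightarrow> - f \<in> carrier (poly_alg n)"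
    and "f \<in> carrier (poly_alg n) \<Longrightarrow> g \<in> carrier (poly_alg n) \<Longrightarrow> f + g \<in> carrier (poly_alg n)"
    and "f \<in> carrier (poly_alg n) \<Longrightarrow> g \<in> carrier (poly_alg n) \<Longrightarrow> f - g \<in> carrier (poly_alg n)"
    and "f \<in> carrier (poly_alg n) \<Longrightarrow> g \<in> carrier (poly_alg n) \<Longrightarrow> f * g \<in> carrier (poly_alg n)"
proof -
  show "Const c \<in> carrier (poly_alg n)"
    by (auto simp: carrier_poly_alg Const_def)
  assume f: "f \<in> carrier (poly_alg n)"
  then show "- f \<in> carrier (poly_alg n)"
    by (auto simp: carrier_poly_alg in_keys_iff)
  assume g: "g \<in> carrier (poly_alg n)"
  show "f + g \<in> carrier (poly_alg n)"
    using f g Poly_Mapping.keys_add[of f g] unfolding carrier_poly_alg by blast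
  show "f - g \<in> carrier (poly_alg n)"
    using f g keys_diff_subset[of f g] unfolding carrier_poly_alg by blast
  show "f * g \<in> carrier (poly_alg n)"
  proof -
    have "Poly_Mapping.keys (a + b) \<subseteq> {1..n}"
      if "a \<in> Poly_Mapping.keys f" "b \<in> Poly_Mapping.keys g" for a b
    proof -
      have "Poly_Mapping.keys a \<subseteq> {1..n}" "Poly_Mapping.keys b \<subseteq> {1..n}"
        using that f g unfolding carrier_poly_alg by blast+
      with Poly_Mapping.keys_add[of a b] show ?thesis by blast
    qed
    then show ?thesis
      using keys_mult[of f g] unfolding carrier_poly_alg by blast
  qed
qed (simp_all add: carrier_poly_alg)

lemma poly_alg_closed_prod [intro]:
  "(\<And>i. i \<in> J \<Longrightarrow> f i \<in> carrier (poly_alg n)) \<Longrightarrow> prod f J \<in> carrier (poly_alg n)"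
  by (induction J rule: infinite_finite_induct) auto

lemma poly_alg_closed_power [simp, intro]:
  "f \<in> carrier (poly_alg n) \<Longrightarrow> f ^ a \<in> carrier (poly_alg n)"
  by (induction a) auto

lemma Var_in_poly_alg [simp]: "Var i \<in> carrier (poly_alg n) \<longleftrightarrow> i \<in> {1..n}"
  by (simp add: Var_def)

lemma cring_poly_alg: "cring (poly_alg n)"
proof (rule cringI)
  show "abelian_group (poly_alg n :: ('k::field, _) module)"
    by (rule abelian_groupI) (auto simp: add.assoc add.commute intro: exI[of _ "- _"] bexI[of _ "- _"])
  show "Group.comm_monoid (poly_alg n :: ('k::field, _) module)"
    by (rule comm_monoidI) (auto simp: mult.assoc mult.commute)
qed (simp add: distrib_right)

locale graded_presentation =
  fixes n :: nat and d :: "exponent \<Rightarrow> 'g" and E :: "'k::field mpoly set"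
  assumes relations: "E \<subseteq> carrier (poly_alg n)"
begin

abbreviation I :: "'k mpoly set" where "I \<equiv> Idl\<^bsub>poly_alg n\<^esub> E"

abbreviation A :: "('k, 'k mpoly set, 'g) graded_alg" where "A \<equiv> graded_quotient n d E"

definition cls :: "'k mpoly \<Rightarrow> 'k mpoly set" where
  "cls f = I +>\<^bsub>poly_alg n\<^esub> f"

sublocale P: cring "poly_alg n"
  by (rule cring_poly_alg)

sublocale I: ideal I "poly_alg n"
  by (rule P.genideal_ideal[OF relations])

lemma I_subset: "f \<in> I \<Longrightarrow> f \<in> carrier (poly_alg n)"
  using I.a_subset by auto

lemma I_mult: "f \<in> carrier (poly_alg n) \<Longrightarrow> g \<in> I \<Longrightarrow> f * g \<in> I"
  using I.I_l_closed[of g f] by simp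

lemma I_add: "f \<in> I \<Longrightarrow> g \<in> I \<Longrightarrow> f + g \<in> I"
  using I.a_closed[of f g] by simp

lemma I_0: "0 \<in> I"
  using I.zero_closed by simp

lemma I_uminus: "g \<in> I \<Longrightarrow> - g \<in> I"
  using I_mult[of "- 1" g] by simp

lemma I_cong_mult:
  assumes "f - f' \<in> I" "g - g' \<in> I"
    and "f' \<in> carrier (poly_alg n)" "g \<in> carrier (poly_alg n)"
  shows "f * g - f' * g' \<in> I"
proof -
  have "f * g - f' * g' = g * (f - f') + f' * (g - g')"
    by (simp add: algebra_simps)
  then show ?thesis using assms by (simp add: I_add I_mult)
qed

lemma I_cong_power:
  assumes "f - f' \<in> I" "f \<in> carrier (poly_alg n)" "f' \<in> carrier (poly_alg n)"
  shows "f ^ a - f' ^ a \<in> I"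
  by (induction a) (use assms in \<open>auto simp: I_0 intro: I_cong_mult\<close>)

lemma I_cong_prod:
  assumes "\<And>i. i \<in> J \<Longrightarrow> f i - g i \<in> I"
    and "\<And>i. i \<in> J \<Longrightarrow> f i \<in> carrier (poly_alg n)" "\<And>i. i \<in> J \<Longrightarrow> g i \<in> carrier (poly_alg n)"
  shows "prod f J - prod g J \<in> I"
  using assms
  by (induction J rule: infinite_finite_induct) (auto simp: I_0 intro!: I_cong_mult poly_alg_closed_prod)

lemma I_trans: "f - g \<in> I \<Longrightarrow> g - h \<in> I \<Longrightarrow> f - h \<in> I"
  using I_add[of "f - g" "g - h"] by simp

lemma I_sym: "f - g \<in> I \<Longrightarrow> g - f \<in> I"
  using I_uminus[of "f - g"] by simp

lemma cls_eq_iff: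
  assumes "f \<in> carrier (poly_alg n)" "g \<in> carrier (poly_alg n)"
  shows "cls f = cls g \<longleftrightarrow> f - g \<in> I"
proof -
  have "f \<ominus>\<^bsub>poly_alg n\<^esub> g = f - g"
  proof -
    have "\<ominus>\<^bsub>poly_alg n\<^esub> g = - g"
      using assms by (intro P.minus_equality) auto
    then show ?thesis by (simp add: a_minus_def)
  qed
  then show ?thesis
    using P.quotient_eq_iff_same_a_r_cos[OF I.ideal_axioms assms] by (simp add: cls_def)
qed

lemma carrier_A: "carrier A = cls ` carrier (poly_alg n)"
  by (auto simp: graded_quotient_def Let_def FactRing_simps cls_def)

lemma cls_in_A [simp]: "f \<in> carrier (poly_alg n) \<Longrightarrow> cls f \<in> carrier A"
  by (simp add: carrier_A)

lemma A_mult: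
  "f \<in> carrier (poly_alg n) \<Longrightarrow> g \<in> carrier (poly_alg n) \<Longrightarrow> cls f \<otimes>\<^bsub>A\<^esub> cls g = cls (f * g)"
  by (simp add: graded_quotient_def Let_def FactRing_simps cls_def I.rcoset_mult_add)

lemma A_add:
  "f \<in> carrier (poly_alg n) \<Longrightarrow> g \<in> carrier (poly_alg n) \<Longrightarrow> cls f \<oplus>\<^bsub>A\<^esub> cls g = cls (f + g)"
  by (simp add: graded_quotient_def Let_def FactRing_simps cls_def I.a_rcos_sum)

lemma A_one: "\<one>\<^bsub>A\<^esub> = cls 1"
  by (simp add: graded_quotient_def Let_def FactRing_simps cls_def)

lemma A_zero: "\<zero>\<^bsub>A\<^esub> = cls 0"
  using P.a_coset_add_zero[OF I.a_subset]
  by (simp add: graded_quotient_def Let_def FactRing_simps cls_def)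

text \<open>All cosets in the union that defines the scalar action coincide: another representative
  of \<open>cls f\<close> differs from \<open>f\<close> by some \<open>h\<close> in
  \<open>I\<close>, and \<open>Const c * h\<close> lies in \<open>I\<close> again.\<close>

lemma A_smult:
  assumes f: "f \<in> carrier (poly_alg n)"
  shows "c \<odot>\<^bsub>A\<^esub> cls f = cls (Const c * f)"
proof -
  have g: "cls (Const c * g) = cls (Const c * f)" if "g \<in> cls f" for g
  proof -
    from that obtain h where h: "h \<in> I" "g = h + f"
      by (auto simp: cls_def a_r_coset_def')
    then have "Const c * g - Const c * f = Const c * h"
      by (simp add: algebra_simps)
    then show ?thesis
      using f h I_subset[of h] by (simp add: cls_eq_iff I_mult)
  qed
  have "f \<in> cls f"
    using f I_0 by (force simp: cls_def a_r_coset_def')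
  with g have "(\<Union>g\<in>cls f. cls (Const c * g)) = cls (Const c * f)"
    by blast
  then show ?thesis
    by (simp add: graded_quotient_def Let_def cls_def)
qed

lemma A_homog:
  "homog A g = cls ` {f \<in> carrier (poly_alg n). \<forall>m\<in>Poly_Mapping.keys f. d m = g}"
  by (simp add: graded_quotient_def Let_def cls_def)

sublocale A: cring A
proof (rule cringI)
  show "abelian_group A"
  proof (rule abelian_groupI)
    fix a assume "a \<in> carrier A"
    then obtain f where "a = cls f" "f \<in> carrier (poly_alg n)"
      by (auto simp: carrier_A)
    then show "\<exists>b\<in>carrier A. b \<oplus>\<^bsub>A\<^esub> a = \<zero>\<^bsub>A\<^esub>"
      by (intro bexI[of _ "cls (- f)"]) (auto simp: A_add A_zero)
  qed (auto simp: carrier_A A_add A_zero ac_simps)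
  show "Group.comm_monoid A"
    by (rule comm_monoidI) (auto simp: carrier_A A_mult A_one ac_simps)
qed (auto simp: carrier_A A_mult A_add distrib_right)

lemma A_power: "f \<in> carrier (poly_alg n) \<Longrightarrow> cls f [^]\<^bsub>A\<^esub> (a::nat) = cls (f ^ a)"
  by (induction a) (simp_all add: A_one A_mult mult.commute)

lemma A_uminus: "f \<in> carrier (poly_alg n) \<Longrightarrow> \<ominus>\<^bsub>A\<^esub> cls f = cls (- f)"
  by (rule A.minus_equality) (auto simp: A_add A_zero)

text \<open>Made for normal form maps \<open>L\<close>, which are additive but not multiplicative.
  The elements all of whose multiples are killed by \<open>L\<close> still form an ideal
  \<open>?K\<close>; it contains \<open>E\<close>, hence \<open>I\<close>, and the multiple by 1
  gives the claim.\<close>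

lemma I_induct_vanishing:
  assumes lin: "\<And>f g. L (f + g) = L f + L g" "\<And>f. L (- f) = - L f"
    and van: "\<And>f e. e \<in> E \<Longrightarrow> f \<in> carrier (poly_alg n) \<Longrightarrow> L (f * e) = (0 :: 'k mpoly)"
    and "f \<in> I"
  shows "L f = 0"
proof -
  let ?K = "{g \<in> carrier (poly_alg n). \<forall>f\<in>carrier (poly_alg n). L (f * g) = 0}"
  have "L 0 = 0"
    using lin(1)[of 0 0] by (simp only: add_0_right add_cancel_right_right)
  then have "ideal ?K (poly_alg n)"
  proof (intro idealI P.ring_axioms)
    show "subgroup ?K (add_monoid (poly_alg n))"
    proof (rule P.add.subgroupI)
      fix a assume "a \<in> ?K"
      moreover from this have "\<ominus>\<^bsub>poly_alg n\<^esub> a = - a"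
        by (intro P.minus_equality) auto
      ultimately show "\<ominus>\<^bsub>poly_alg n\<^esub> a \<in> ?K"
        by (auto simp: lin)
    qed (use \<open>L 0 = 0\<close> in \<open>auto simp: lin distrib_left\<close>)
  next
    fix a x :: "'k mpoly" assume "a \<in> ?K" "x \<in> carrier (poly_alg n)"
    then have *: "x * a \<in> ?K"
      by (auto simp flip: mult.assoc)
    then show "x \<otimes>\<^bsub>poly_alg n\<^esub> a \<in> ?K"
      by simp
    from * show "a \<otimes>\<^bsub>poly_alg n\<^esub> x \<in> ?K"
      by (simp add: mult.commute[of a])
  qed
  moreover have "E \<subseteq> ?K"
    using relations van by auto
  ultimately have "I \<subseteq> ?K"
    by (rule P.genideal_minimal)
  with \<open>f \<in> I\<close> have "\<forall>g\<in>carrier (poly_alg n). L (g * f) = 0"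
    by auto
  from bspec[OF this, of 1] show ?thesis
    by simp
qed

section \<open>Sums of homogeneous components as classes of polynomials\<close>

definition supported :: "'g set \<Rightarrow> 'k mpoly set" where
  "supported J = {f \<in> carrier (poly_alg n). \<forall>m\<in>Poly_Mapping.keys f. d m \<in> J}"

lemma supported_add: "f \<in> supported J \<Longrightarrow> g \<in> supported J \<Longrightarrow> f + g \<in> supported J"
  using Poly_Mapping.keys_add[of f g] by (auto simp: supported_def)

lemma supported_0: "0 \<in> supported J"
  by (simp add: supported_def)

lemma supported_sum: "(\<And>i. i \<in> F \<Longrightarrow> p i \<in> supported J) \<Longrightarrow> sum p F \<in> supported J"
  by (induction F rule: infinite_finite_induct) (auto simp: supported_0 supported_add)

lemma supported_scale: "f \<in> supported J \<Longrightarrow> Const c * f \<in> supported J"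
  using keys_Const_mult[of c f] by (auto simp: supported_def)

context
  fixes B :: "('k, 'k mpoly set, 'g) graded_alg" and J :: "'g set"
  assumes B: "abelian_monoid B" "ring.add B = ring.add A" "ring.zero B = ring.zero A"
    "homog B = homog A" "cls ` supported J \<subseteq> carrier B"
begin

text \<open>\<open>B\<close> stands for \<open>A\<close> or for a restriction of it to a smaller
  carrier: \<open>homog_sum\<close> is formed in \<open>S_alg T\<close> to define the carrier of
  \<open>S_H T\<close>, and again in \<open>S_H T\<close> for the push-forward. Since
  \<open>finsum\<close> depends on the carrier, \<open>B\<close> must contain the classes in
  question.\<close>

lemma finsum_cls:
  assumes "finite F" "\<And>i. i \<in> F \<Longrightarrow> p i \<in> supported J"
  shows "finsum B (\<lambda>i. cls (p i)) F = cls (sum p F)"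
proof -
  interpret B: abelian_monoid B by fact
  show ?thesis
    using assms
  proof (induction rule: finite_induct)
    case empty
    then show ?case by (simp add: B A_zero)
  next
    case (insert i F)
    then have "finsum B (\<lambda>i. cls (p i)) (insert i F) = cls (p i) \<oplus>\<^bsub>A\<^esub> cls (sum p F)"
      using B(5) by (subst B.finsum_insert) (auto simp: B(2))
    also have "\<dots> = cls (p i + sum p F)"
      using insert supported_sum[of F p J] by (intro A_add) (auto simp: supported_def)
    finally show ?case using insert by simp
  qed
qed

lemma homog_sum_cls: "homog_sum B J = cls ` supported J"
proof -
  interpret B: abelian_monoid B by fact
  have homog: "homog A g = cls ` supported {g}" for g
    by (simp add: A_homog supported_def)
  show ?thesis
  proof (intro equalityI subsetI)
    fix a assume "a \<in> homog_sum B J"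
    then obtain f F where f: "a = finsum B f F" "finite F" "F \<subseteq> J" "\<forall>g\<in>F. f g \<in> homog A g"
      by (auto simp: homog_sum_def B)
    from f(4) have "\<exists>p. \<forall>g\<in>F. p g \<in> supported {g} \<and> f g = cls (p g)"
      unfolding homog by (intro bchoice) auto
    then obtain p where p: "\<And>g. g \<in> F \<Longrightarrow> p g \<in> supported {g} \<and> f g = cls (p g)"
      by auto
    then have pJ: "p g \<in> supported J" if "g \<in> F" for g
      using that f(3) by (force simp: supported_def)
    have "a = finsum B (\<lambda>i. cls (p i)) F"
      unfolding f(1) using p pJ B(5) by (intro B.finsum_cong') auto
    then show "a \<in> cls ` supported J"
      using pJ f(2) by (simp add: finsum_cls supported_sum)
  next
    fix a assume "a \<in> cls ` supported J"
    then obtain f where f: "f \<in> supported J" "a = cls f" by auto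
    \<comment> \<open>\<open>F\<close> is the set of degrees occurring in \<open>f\<close>, and
      \<open>p g\<close> collects the terms of degree \<open>g\<close>.\<close>
    define F where "F = d ` Poly_Mapping.keys f"
    define p where "p g = (\<Sum>m\<in>{m \<in> Poly_Mapping.keys f. d m = g}.
      Poly_Mapping.single m (Poly_Mapping.lookup f m))" for g
    have F: "finite F" "F \<subseteq> J"
      using f(1) by (auto simp: F_def supported_def)
    have p: "p g \<in> supported {g}" for g
      unfolding p_def using f(1)
      by (intro supported_sum) (auto simp: supported_def carrier_poly_alg)
    have "sum p F = f"
      unfolding p_def F_def by (subst sum.image_gen[symmetric]) (simp_all flip: mpoly_expansion)
    moreover have "p g \<in> supported J" if "g \<in> F" for g
      using p[of g] that F(2) by (auto simp: supported_def)
    ultimately have "a = finsum B (\<lambda>g. cls (p g)) F"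
      using F f(2) by (simp add: finsum_cls)
    moreover have "cls (p g) \<in> homog B g" for g
      using p by (simp add: B homog)
    ultimately show "a \<in> homog_sum B J"
      unfolding homog_sum_def using F by blast
  qed
qed

end

end

section \<open>Degrees in the string group\<close>

locale weight_sequence =
  fixes p :: "nat list"
  assumes weight_pos: "i \<in> {1..length p} \<Longrightarrow> 0 < weight p i"
    and nonempty: "1 \<le> length p"
begin

declare One_nat_def [simp del]

abbreviation F :: "(nat \<Rightarrow>\<^sub>0 int) monoid" where
  "F \<equiv> free_Abelian_group {1..length p}"

abbreviation L :: "(nat \<Rightarrow>\<^sub>0 int) set monoid" where "L \<equiv> string_group p"

definition proj :: "(nat \<Rightarrow>\<^sub>0 int) \<Rightarrow> (nat \<Rightarrow>\<^sub>0 int) set" where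
  "proj v = string_relations p #>\<^bsub>F\<^esub> v"

sublocale F: comm_group F
  by (rule abelian_free_Abelian_group)

lemma relation_in_F:
  assumes "i \<in> {1..length p}" "j \<in> {1..length p}"
  shows "Poly_Mapping.keys (frag_cmul a (frag_of i) - frag_cmul b (frag_of j)) \<subseteq> {1..length p}"
  using assms keys_diff[of "frag_cmul a (frag_of i)" "frag_cmul b (frag_of j)"]
    keys_cmul[of a "frag_of i"] keys_cmul[of b "frag_of j"] by (auto simp: keys_frag_of)

lemma subgroup_relations: "subgroup (string_relations p) F"
  unfolding string_relations_def using relation_in_F
  by (intro F.generate_is_subgroup) (auto simp del: keys_cmul_iff)

text \<open>The conditions define a subgroup that contains the generating relations. Conversely, if
  the quotients \<open>c i\<close> add up to zero, then \<open>r\<close> is the sum of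
  \<open>c i\<close> times the relation between \<open>i\<close> and 1, because the corrections at
  the first coordinate cancel. Equality in L(p) thus becomes a matter of divisibility.\<close>

lemma string_relations_iff:
  "r \<in> string_relations p \<longleftrightarrow> Poly_Mapping.keys r \<subseteq> {1..length p} \<and>
    (\<forall>i\<in>{1..length p}. int (weight p i) dvd Poly_Mapping.lookup r i) \<and>
    (\<Sum>i\<in>{1..length p}. Poly_Mapping.lookup r i div int (weight p i)) = 0"
    (is "_ \<longleftrightarrow> ?rel r")
proof
  let ?G = "{frag_cmul (int (weight p i)) (frag_of i) - frag_cmul (int (weight p j)) (frag_of j) | i j.
          i \<in> {1..length p} \<and> j \<in> {1..length p}}"
  have div_sum: "(\<Sum>i\<in>{1..length p}. (a i + b i) div int (weight p i)) =
      (\<Sum>i\<in>{1..length p}. a i div int (weight p i)) + (\<Sum>i\<in>{1..length p}. b i div int (weight p i))"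
    if "\<forall>i\<in>{1..length p}. int (weight p i) dvd a i" for a b :: "nat \<Rightarrow> int"
    unfolding sum.distrib[symmetric] using that by (intro sum.cong refl div_plus_div_distrib_dvd_left) auto
  have div_minus: "(\<Sum>i\<in>{1..length p}. (- a i) div int (weight p i)) =
      - (\<Sum>i\<in>{1..length p}. a i div int (weight p i))"
    if "\<forall>i\<in>{1..length p}. int (weight p i) dvd a i" for a :: "nat \<Rightarrow> int"
    unfolding sum_negf[symmetric] using that by (intro sum.cong refl dvd_neg_div) auto
  have "subgroup {r. ?rel r} F"
  proof (rule F.subgroupI)
    fix a assume "a \<in> {r. ?rel r}"
    then show "inv\<^bsub>F\<^esub> a \<in> {r. ?rel r}"
      using div_minus[of "Poly_Mapping.lookup a"] by auto
  next
    fix a b assume "a \<in> {r. ?rel r}" "b \<in> {r. ?rel r}"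
    then show "a \<otimes>\<^bsub>F\<^esub> b \<in> {r. ?rel r}"
      using div_sum[of "Poly_Mapping.lookup a" "Poly_Mapping.lookup b"] Poly_Mapping.keys_add[of a b]
      by (auto simp: lookup_add)
  qed (auto intro!: exI[of _ 0])
  moreover have "?G \<subseteq> {r. ?rel r}"
  proof clarify
    fix i j assume ij: "i \<in> {1..length p}" "j \<in> {1..length p}"
    let ?a = "\<lambda>l. if l = i then int (weight p i) else 0"
    let ?b = "\<lambda>l. if l = j then int (weight p j) else 0"
    let ?r = "frag_cmul (int (weight p i)) (frag_of i) - frag_cmul (int (weight p j)) (frag_of j)"
    have r: "Poly_Mapping.lookup ?r l = ?a l + (- ?b l)" for l
      by (simp add: lookup_minus lookup_single when_def)
    have "?a l div int (weight p l) = (if l = i then 1 else 0)"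
      "?b l div int (weight p l) = (if l = j then 1 else 0)" for l
      using ij weight_pos by auto
    then have "(\<Sum>l\<in>{1..length p}. ?a l div int (weight p l)) = 1"
      "(\<Sum>l\<in>{1..length p}. ?b l div int (weight p l)) = 1"
      using ij by simp_all
    with div_sum[of ?a "\<lambda>l. - ?b l"] div_minus[of ?b]
    show "?rel ?r"
      unfolding r using relation_in_F[OF ij] by auto
  qed
  ultimately have "string_relations p \<subseteq> {r. ?rel r}"
    unfolding string_relations_def by (intro F.generate_subgroup_incl)
  moreover assume "r \<in> string_relations p"
  ultimately show "?rel r" by auto
next
  assume r: "?rel r"
  define c where "c i = Poly_Mapping.lookup r i div int (weight p i)" for i
  define g where "g i = frag_cmul (int (weight p i)) (frag_of i) - frag_cmul (int (weight p 1)) (frag_of 1)" for i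
  have g: "frag_cmul (c i) (g i) \<in> string_relations p" if "i \<in> {1..length p}" for i
  proof -
    have "g i \<in> string_relations p"
      unfolding string_relations_def g_def using that nonempty
      by (intro generate.incl CollectI exI[of _ i] exI[of _ 1]) auto
    moreover have "Poly_Mapping.keys (g i) \<subseteq> {1..length p}"
      unfolding g_def using that nonempty by (intro relation_in_F) auto
    ultimately show ?thesis
      using F.subgroup_int_pow_closed[OF subgroup_relations, of "g i" "c i"] by simp
  qed
  have "sum (\<lambda>i. frag_cmul (c i) (g i)) J \<in> string_relations p" if "J \<subseteq> {1..length p}" for J
  proof -
    have "finite J" using that finite_subset by blast
    then show ?thesis using that
    proof (induction rule: finite_induct)
      case empty
      then show ?case using subgroup.one_closed[OF subgroup_relations] by simp
    next
      case (insert i J)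
      then show ?case
        using subgroup.m_closed[OF subgroup_relations] g by simp
    qed
  qed
  moreover have "r = sum (\<lambda>i. frag_cmul (c i) (g i)) {1..length p}"
  proof (rule poly_mapping_eqI)
    fix j :: nat
    have "(\<Sum>i\<in>{1..length p}. c i * (int (weight p 1) when 1 = j)) = 0"
      using r by (simp flip: sum_distrib_right add: c_def)
    moreover have "(\<Sum>i\<in>{1..length p}. c i * (int (weight p i) when i = j)) = Poly_Mapping.lookup r j"
      using r by (cases "j \<in> {1..length p}") (auto simp: when_def c_def if_distrib in_keys_iff cong: if_cong)
    moreover have "Poly_Mapping.lookup (frag_cmul (c i) (g i)) j =
        c i * (int (weight p i) when i = j) - c i * (int (weight p 1) when 1 = j)" for i
      by (simp add: g_def lookup_minus lookup_single mult_when right_diff_distrib when_def)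
    ultimately show "Poly_Mapping.lookup r j = Poly_Mapping.lookup (sum (\<lambda>i. frag_cmul (c i) (g i)) {1..length p}) j"
      by (simp only: lookup_sum sum_subtractf)
  qed
  ultimately show "r \<in> string_relations p" by simp
qed

sublocale L: comm_group L
  unfolding string_group_def using F.abelian_FactGroup[OF subgroup_relations] .

sublocale proj: group_hom F L proj
proof -
  interpret normal "string_relations p" F
    using F.subgroup_imp_normal[OF subgroup_relations] .
  show "group_hom F L proj"
    using r_coset_hom_Mod L.group_axioms F.group_axioms
    by (simp add: group_hom_def group_hom_axioms_def proj_def[abs_def] string_group_def)
qed

lemma proj_eq_iff:
  assumes "Poly_Mapping.keys u \<subseteq> {1..length p}" "Poly_Mapping.keys v \<subseteq> {1..length p}"
  shows "proj u = proj v \<longleftrightarrow> u - v \<in> string_relations p"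
proof -
  have "u \<otimes>\<^bsub>F\<^esub> inv\<^bsub>F\<^esub> v = u - v"
    using assms by simp
  then have "u \<in> proj v \<longleftrightarrow> u - v \<in> string_relations p"
    using assms subgroup.rcos_module[OF subgroup_relations F.group_axioms, of v u]
    unfolding proj_def by (simp only: carrier_free_Abelian_group_iff)
  moreover have "u \<in> proj u"
    using F.rcos_self[OF _ subgroup_relations, of u] assms by (simp add: proj_def)
  moreover have "proj v = proj u" if "u \<in> proj v"
    using F.repr_independence[OF that[unfolded proj_def] _ subgroup_relations] assms
    by (simp add: proj_def)
  ultimately show ?thesis by auto
qed

lemma proj_closed: "Poly_Mapping.keys u \<subseteq> {1..length p} \<Longrightarrow> proj u \<in> carrier L"
  using proj.hom_closed[of u] by simp

lemma proj_sum:
  assumes "finite J" "\<And>j. j \<in> J \<Longrightarrow> Poly_Mapping.keys (u j) \<subseteq> {1..length p}"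
  shows "finprod L (\<lambda>j. proj (u j)) J = proj (sum u J)"
  using assms
proof (induction rule: finite_induct)
  case empty
  then show ?case using proj.hom_one by simp
next
  case (insert j J)
  then have "Poly_Mapping.keys (sum u J) \<subseteq> {1..length p}"
    using keys_sum[of u J] by fastforce
  then have "proj (u j) \<otimes>\<^bsub>L\<^esub> proj (sum u J) = proj (u j + sum u J)"
    using insert proj.hom_mult[of "u j" "sum u J"] by simp
  moreover have "finprod L (\<lambda>j. proj (u j)) (insert j J) =
      proj (u j) \<otimes>\<^bsub>L\<^esub> finprod L (\<lambda>j. proj (u j)) J"
    using insert by (intro L.finprod_insert) (auto simp: proj_closed)
  ultimately show ?case using insert by simp
qed

lemma keys_frag_cmul_frag_of: "i \<in> J \<Longrightarrow> Poly_Mapping.keys (frag_cmul a (frag_of i)) \<subseteq> J"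
  by (auto simp: keys_frag_of)

lemma proj_nat_pow:
  "Poly_Mapping.keys u \<subseteq> {1..length p} \<Longrightarrow> proj u [^]\<^bsub>L\<^esub> (a::nat) = proj (frag_cmul (int a) u)"
  using proj.hom_nat_pow[of u a] by simp

lemma proj_int_pow:
  "Poly_Mapping.keys u \<subseteq> {1..length p} \<Longrightarrow> proj u [^]\<^bsub>L\<^esub> (a::int) = proj (frag_cmul a u)"
  using proj.hom_int_pow[of u a] by simp

section \<open>Lifts of degrees, of omega and of the elements of H to the free abelian group, with c
  lifted to p_1 x_1\<close>

definition vec :: "exponent \<Rightarrow> nat \<Rightarrow>\<^sub>0 int" where
  "vec m = (\<Sum>i\<in>{1..length p}. frag_cmul (int (Poly_Mapping.lookup m i)) (frag_of i))"

definition wvec :: "nat \<Rightarrow>\<^sub>0 int" where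
  "wvec = frag_cmul ((int (length p) - 2) * int (weight p 1)) (frag_of 1) - (\<Sum>i\<in>{1..length p}. frag_of i)"

definition hvec :: "int \<Rightarrow> int \<Rightarrow> nat \<Rightarrow>\<^sub>0 int" where
  "hvec k e = frag_cmul (3 * k) (frag_of 1) + frag_cmul e wvec"

lemma xvec_proj: "xvec p i = proj (frag_of i)"
  by (simp add: xvec_def proj_def)

lemma string_degree_proj: "string_degree p m = proj (vec m)"
proof -
  have "string_degree p m =
      finprod L (\<lambda>i. proj (frag_cmul (int (Poly_Mapping.lookup m i)) (frag_of i))) {1..length p}"
    unfolding string_degree_def
    by (rule L.finprod_cong')
      (auto simp: xvec_proj proj_nat_pow keys_frag_of intro!: proj_closed)
  also have "\<dots> = proj (vec m)"
    unfolding vec_def by (rule proj_sum) (auto simp: keys_frag_of)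
  finally show ?thesis .
qed

lemma omega_proj: "omega p = proj wvec"
proof -
  have keys: "Poly_Mapping.keys (\<Sum>i\<in>{1..length p}. frag_of i) \<subseteq> {1..length p}"
    using keys_sum[of frag_of "{1..length p}"] by (auto simp: keys_frag_of)
  let ?a = "frag_cmul ((int (length p) - 2) * int (weight p 1)) (frag_of 1)"
  have a: "Poly_Mapping.keys ?a \<subseteq> {1..length p}"
    using nonempty by (intro keys_frag_cmul_frag_of) auto
  have "cvec p = proj (frag_cmul (int (weight p 1)) (frag_of 1))"
    using nonempty by (simp add: cvec_def xvec_proj proj_nat_pow keys_frag_of)
  then have "cvec p [^]\<^bsub>L\<^esub> (int (length p) - 2) = proj ?a"
    using nonempty keys_frag_cmul_frag_of[of 1 "{1..length p}"] by (simp add: proj_int_pow)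
  moreover have "finprod L (xvec p) {1..length p} = proj (\<Sum>i\<in>{1..length p}. frag_of i)"
    using proj_sum[of "{1..length p}" frag_of] by (simp add: xvec_proj[abs_def] keys_frag_of)
  moreover have "inv\<^bsub>L\<^esub> proj (\<Sum>i\<in>{1..length p}. frag_of i) = proj (- (\<Sum>i\<in>{1..length p}. frag_of i))"
    using proj.hom_inv[of "\<Sum>i\<in>{1..length p}. frag_of i"] keys by simp
  ultimately show ?thesis
    using proj.hom_mult[of ?a "- (\<Sum>i\<in>{1..length p}. frag_of i)"] a keys
    by (simp add: omega_def wvec_def)
qed

lemma keys_wvec: "Poly_Mapping.keys wvec \<subseteq> {1..length p}"
  unfolding wvec_def
  using nonempty keys_frag_cmul_frag_of[of 1 "{1..length p}"] keys_sum[of frag_of "{1..length p}"]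
  by (intro order.trans[OF keys_diff] Un_least) (auto simp: keys_frag_of)

lemma keys_vec: "Poly_Mapping.keys (vec m) \<subseteq> {1..length p}"
  unfolding vec_def
  by (intro order.trans[OF keys_sum]) (auto simp: keys_frag_of)

lemma keys_hvec: "Poly_Mapping.keys (hvec k e) \<subseteq> {1..length p}"
  unfolding hvec_def
  using nonempty keys_wvec keys_frag_cmul_frag_of[of 1 "{1..length p}"] keys_cmul[of e wvec]
  by (intro order.trans[OF Poly_Mapping.keys_add] Un_least) (auto simp: keys_frag_of)

lemma proj_hvec:
  "proj (hvec k e) = (xvec p 1 [^]\<^bsub>L\<^esub> (3::nat)) [^]\<^bsub>L\<^esub> k \<otimes>\<^bsub>L\<^esub> omega p [^]\<^bsub>L\<^esub> e"
proof -
  have "(xvec p 1 [^]\<^bsub>L\<^esub> (3::nat)) [^]\<^bsub>L\<^esub> k = proj (frag_cmul (3 * k) (frag_of 1))"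
    using nonempty keys_frag_cmul_frag_of[of 1 "{1..length p}"]
    by (simp add: xvec_proj proj_nat_pow proj_int_pow keys_frag_of mult.commute)
  moreover have "omega p [^]\<^bsub>L\<^esub> e = proj (frag_cmul e wvec)"
    by (simp add: omega_proj proj_int_pow keys_wvec)
  ultimately show ?thesis
    using proj.hom_mult[of "frag_cmul (3 * k) (frag_of 1)" "frag_cmul e wvec"] nonempty
      keys_frag_cmul_frag_of[of 1 "{1..length p}"] keys_wvec keys_cmul[of e wvec]
    by (simp add: hvec_def subset_iff)
qed

lemma H_generators:
  "xvec p 1 [^]\<^bsub>L\<^esub> (3::nat) \<in> carrier L" "omega p \<in> carrier L"
  using nonempty by (auto simp: xvec_proj omega_proj keys_frag_of keys_wvec intro!: proj_closed)

text \<open>In an abelian group the products of powers of two elements already form a subgroup. No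
  uniqueness of \<open>k\<close> and \<open>e\<close> is claimed at this point.\<close>

lemma carrier_H_group: "carrier (H_group p) = {proj (hvec k e) | k e. True}"
proof -
  let ?X = "{xvec p 1 [^]\<^bsub>L\<^esub> (3::nat), omega p}"
  have X: "?X \<subseteq> carrier L"
    using H_generators by simp
  then have gen: "carrier (H_group p) = generate L ?X"
    by (simp add: H_group_def carrier_subgroup_generated Int_absorb1)
  have sub: "subgroup (generate L ?X) L"
    by (rule L.generate_is_subgroup[OF X])
  have add: "hvec k e + hvec k' e' = hvec (k + k') (e + e')" for k e k' e'
    by (simp add: hvec_def frag_cmul_distrib distrib_left ac_simps)
  have minus: "- hvec k e = hvec (- k) (- e)" for k e
    by (simp add: hvec_def)
  have "subgroup {proj (hvec k e) | k e. True} L"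
  proof (rule L.subgroupI)
    fix a assume "a \<in> {proj (hvec k e) | k e. True}"
    then obtain k e where "a = proj (hvec k e)" by auto
    then have "inv\<^bsub>L\<^esub> a = proj (hvec (- k) (- e))"
      using proj.hom_inv[of "hvec k e"] by (simp add: keys_hvec minus)
    then show "inv\<^bsub>L\<^esub> a \<in> {proj (hvec k e) | k e. True}"
      by blast
  next
    fix a b assume "a \<in> {proj (hvec k e) | k e. True}" "b \<in> {proj (hvec k e) | k e. True}"
    then obtain k e k' e' where "a = proj (hvec k e)" "b = proj (hvec k' e')" by auto
    then have "a \<otimes>\<^bsub>L\<^esub> b = proj (hvec (k + k') (e + e'))"
      using proj.hom_mult[of "hvec k e" "hvec k' e'"] by (simp add: keys_hvec add)
    then show "a \<otimes>\<^bsub>L\<^esub> b \<in> {proj (hvec k e) | k e. True}"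
      by blast
  qed (use proj_closed[OF keys_hvec] in auto)
  moreover have "?X \<subseteq> {proj (hvec k e) | k e. True}"
  proof -
    have "hvec 0 1 = wvec" "hvec 1 0 = frag_cmul 3 (frag_of 1)"
      by (simp_all add: hvec_def)
    then have "omega p = proj (hvec 0 1)" "xvec p 1 [^]\<^bsub>L\<^esub> (3::nat) = proj (hvec 1 0)"
      using nonempty by (simp_all add: omega_proj xvec_proj proj_nat_pow keys_frag_of)
    then show ?thesis by blast
  qed
  ultimately have "generate L ?X \<subseteq> {proj (hvec k e) | k e. True}"
    by (intro L.generate_subgroup_incl)
  moreover have "proj (hvec k e) \<in> generate L ?X" for k e
    unfolding proj_hvec
    by (intro L.subgroup_int_pow_closed[OF sub] subgroup.m_closed[OF sub] generate.incl) auto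
  ultimately show ?thesis
    unfolding gen by blast
qed

text \<open>
  \<open>H_exponent k m\<close> says that the degree of \<open>X\<^sup>m\<close> is \<open>3 k x\<^sub>1 + e \<omega>\<close> for some \<open>e\<close>.
\<close>

definition H_exponent :: "int \<Rightarrow> exponent \<Rightarrow> bool" where
  "H_exponent k m \<longleftrightarrow> (\<exists>e.
    let a = (\<lambda>i. int (Poly_Mapping.lookup m i) + e
      - (if i = 1 then 3 * k + e * (int (length p) - 2) * int (weight p 1) else 0))
    in (\<forall>i\<in>{1..length p}. int (weight p i) dvd a i) \<and>
      (\<Sum>i\<in>{1..length p}. a i div int (weight p i)) = 0)"

text \<open>The quotients become unknowns \<open>c i\<close> with sum zero. In this form the
  condition can be proved by giving witnesses, and exploited by linear arithmetic.\<close>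

lemma H_exponent_iff:
  "H_exponent k m \<longleftrightarrow> (\<exists>e c. (\<forall>i\<in>{1..length p}. int (Poly_Mapping.lookup m i) + e =
      int (weight p i) * c i + (if i = 1 then 3 * k + e * (int (length p) - 2) * int (weight p 1) else 0)) \<and>
    (\<Sum>i\<in>{1..length p}. c i) = 0)"
    (is "_ \<longleftrightarrow> (\<exists>e c. (\<forall>i\<in>_. ?b e i = int (weight p i) * c i + ?d e i) \<and> _)")
proof
  assume "H_exponent k m"
  then obtain e where "\<forall>i\<in>{1..length p}. int (weight p i) dvd ?b e i - ?d e i"
    "(\<Sum>i\<in>{1..length p}. (?b e i - ?d e i) div int (weight p i)) = 0"
    unfolding H_exponent_def Let_def by blast
  then show "\<exists>e c. (\<forall>i\<in>{1..length p}. ?b e i = int (weight p i) * c i + ?d e i) \<and> sum c {1..length p} = 0"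
    by (intro exI[of _ e] exI[of _ "\<lambda>i. (?b e i - ?d e i) div int (weight p i)"]) simp
next
  assume "\<exists>e c. (\<forall>i\<in>{1..length p}. ?b e i = int (weight p i) * c i + ?d e i) \<and> sum c {1..length p} = 0"
  then obtain e c where "\<forall>i\<in>{1..length p}. ?b e i = int (weight p i) * c i + ?d e i"
    and c: "sum c {1..length p} = 0"
    by blast
  then have ec: "?b e i - ?d e i = int (weight p i) * c i" if "i \<in> {1..length p}" for i
    using that by (simp only: add_diff_cancel_right')
  have "(\<Sum>i\<in>{1..length p}. (?b e i - ?d e i) div int (weight p i)) = sum c {1..length p}"
    by (rule sum.cong[OF refl], subst ec) (use weight_pos in auto)
  moreover have "\<forall>i\<in>{1..length p}. int (weight p i) dvd ?b e i - ?d e i"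
    by (intro ballI, subst ec) auto
  ultimately show "H_exponent k m"
    unfolding H_exponent_def Let_def using c by (intro exI[of _ e] conjI) simp_all
qed

lemma string_degree_eq_hvec_iff:
  "(\<exists>e. string_degree p m = proj (hvec k e)) \<longleftrightarrow> H_exponent k m"
proof -
  have lookup: "Poly_Mapping.lookup (vec m - hvec k e) i = int (Poly_Mapping.lookup m i) + e
      - (if i = 1 then 3 * k + e * (int (length p) - 2) * int (weight p 1) else 0)"
    if "i \<in> {1..length p}" for i e
    using that
    by (auto simp: vec_def hvec_def wvec_def lookup_sum lookup_minus lookup_add lookup_single
        when_def algebra_simps if_distrib cong: if_cong)
  have keys: "Poly_Mapping.keys (vec m - hvec k e) \<subseteq> {1..length p}" for e
    using keys_vec keys_hvec keys_diff[of "vec m" "hvec k e"] by blast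
  show ?thesis
    unfolding H_exponent_def Let_def string_degree_proj proj_eq_iff[OF keys_vec keys_hvec]
      string_relations_iff
    using keys by (simp only: lookup simp_thms cong: ball_cong sum.cong)
qed

lemma vec_add: "vec (m + n) = vec m + vec n"
  by (simp add: vec_def lookup_add frag_cmul_distrib sum.distrib)

lemma vec_single:
  "i \<in> {1..length p} \<Longrightarrow> vec (Poly_Mapping.single i a) = frag_cmul (int a) (frag_of i)"
  by (simp add: vec_def lookup_single when_def if_distrib[of int] if_distrib[of "\<lambda>c. frag_cmul c _"] cong: if_cong)

lemma relation_in_string_relations:
  assumes "i \<in> {1..length p}" "j \<in> {1..length p}"
  shows "vec (Poly_Mapping.single i (weight p i)) - vec (Poly_Mapping.single j (weight p j)) \<in> string_relations p"
  unfolding string_relations_def vec_single[OF assms(1)] vec_single[OF assms(2)] using assms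
  by (intro generate.incl CollectI exI[of _ i] exI[of _ j]) simp

lemma string_relations_0: "0 \<in> string_relations p"
  using subgroup.one_closed[OF subgroup_relations] by simp

lemma string_relations_add:
  "r \<in> string_relations p \<Longrightarrow> s \<in> string_relations p \<Longrightarrow> r + s \<in> string_relations p"
  using subgroup.m_closed[OF subgroup_relations] by simp

lemma H_exponent_cong:
  "vec m - vec n \<in> string_relations p \<Longrightarrow> H_exponent k m \<longleftrightarrow> H_exponent k n"
  by (simp flip: string_degree_eq_hvec_iff proj_eq_iff[OF keys_vec keys_vec] add: string_degree_proj)

context
  fixes \<pi> :: "(nat \<Rightarrow>\<^sub>0 int) set \<Rightarrow> int"
  assumes \<pi>: "\<pi> \<in> hom (H_group p) integer_group"
    "\<pi> (xvec p 1 [^]\<^bsub>L\<^esub> (3::nat)) = 1" "\<pi> (omega p) = 0"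
begin

lemma \<pi>_hvec: "\<pi> (proj (hvec k e)) = k"
proof -
  interpret H: group "H_group p"
    unfolding H_group_def by (rule L.group_subgroup_generated)
  interpret \<pi>: group_hom "H_group p" integer_group \<pi>
    using \<pi>(1) H.group_axioms by (simp add: group_hom_def group_hom_axioms_def)
  have X: "xvec p 1 [^]\<^bsub>L\<^esub> (3::nat) \<in> carrier (H_group p)" "omega p \<in> carrier (H_group p)"
    using H_generators by (auto simp: H_group_def carrier_subgroup_generated intro: generate.incl)
  have "proj (hvec k e) =
      (xvec p 1 [^]\<^bsub>L\<^esub> (3::nat)) [^]\<^bsub>H_group p\<^esub> k \<otimes>\<^bsub>H_group p\<^esub> omega p [^]\<^bsub>H_group p\<^esub> e"
    using X unfolding proj_hvec H_group_def
    by (simp add: L.int_pow_subgroup_generated)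
  also have "\<pi> \<dots> = \<pi> (xvec p 1 [^]\<^bsub>L\<^esub> (3::nat)) [^]\<^bsub>integer_group\<^esub> k
      \<otimes>\<^bsub>integer_group\<^esub> \<pi> (omega p) [^]\<^bsub>integer_group\<^esub> e"
    using X by (simp add: \<pi>.hom_int_pow)
  also have "\<dots> = k"
    using \<pi> by simp
  finally show ?thesis .
qed

text \<open>By \<open>\<pi>_hvec\<close> the value of \<open>\<pi>\<close> recovers \<open>k\<close>
  from every representation \<open>proj (hvec k e)\<close>, so the fibre over \<open>k\<close>
  consists exactly of the elements 3 k x_1 + e omega.\<close>

lemma string_degree_in_fibre:
  "string_degree p m \<in> {g \<in> carrier (H_group p). \<pi> g = k} \<longleftrightarrow> H_exponent k m"
  unfolding string_degree_eq_hvec_iff[symmetric] by (auto simp: carrier_H_group \<pi>_hvec)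

lemma string_degree_in_H: "string_degree p m \<in> carrier (H_group p) \<longleftrightarrow> (\<exists>k. H_exponent k m)"
  using string_degree_in_fibre by blast

end

end

section \<open>Normal forms in the algebras of tubular type\<close>

text \<open>The coefficients of X_1^{p_1} in the relations of \<open>S\<close>; only the values at
  indices from 3 on enter these relations.\<close>

fun lam :: "'k::field tubular_type \<Rightarrow> nat \<Rightarrow> 'k" where
  "lam (T2222 l) i = (if i = 4 then l else 1)"
| "lam _ i = 1"

text \<open>The exponent of the monomial \<open>x\<^sup>a y\<^sup>b z\<^sup>c\<close> of \<open>S\<close>, where \<open>m\<close> is the exponent of \<open>X\<^sup>a Y\<^sup>b Z\<^sup>c\<close>.\<close>

fun sub_exponent :: "'k tubular_type \<Rightarrow> exponent \<Rightarrow> exponent" where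
  "sub_exponent (T2222 _) m =
     Poly_Mapping.single 1 (Poly_Mapping.lookup m 1 + 3 * Poly_Mapping.lookup m 3)
     + Poly_Mapping.single 2 (2 * Poly_Mapping.lookup m 1 + Poly_Mapping.lookup m 2)
     + Poly_Mapping.single 3 (Poly_Mapping.lookup m 2) + Poly_Mapping.single 4 (Poly_Mapping.lookup m 2)"
| "sub_exponent T333 m =
     Poly_Mapping.single 1 (Poly_Mapping.lookup m 1 + 3 * Poly_Mapping.lookup m 3)
     + Poly_Mapping.single 2 (Poly_Mapping.lookup m 1 + 3 * Poly_Mapping.lookup m 2)
     + Poly_Mapping.single 3 (Poly_Mapping.lookup m 1)"
| "sub_exponent T442 m =
     Poly_Mapping.single 1 (Poly_Mapping.lookup m 1 + 3 * Poly_Mapping.lookup m 3)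
     + Poly_Mapping.single 2 (2 * Poly_Mapping.lookup m 1 + Poly_Mapping.lookup m 2)
     + Poly_Mapping.single 3 (Poly_Mapping.lookup m 2)"
| "sub_exponent T632 m =
     Poly_Mapping.single 1 (Poly_Mapping.lookup m 1 + 3 * Poly_Mapping.lookup m 3)
     + Poly_Mapping.single 2 (Poly_Mapping.lookup m 1)
     + Poly_Mapping.single 3 (Poly_Mapping.lookup m 2)"

text \<open>The relation of \<open>R\<close> solved for X^3: the polynomial to which X^3 is
  congruent, of degree at most 2 in X.\<close>

fun cubic_rest :: "'k::field tubular_type \<Rightarrow> 'k mpoly" where
  "cubic_rest (T2222 l) = Const (1 + l) * (Var 1 ^ 2 * Var 3) - Const l * (Var 1 * Var 3 ^ 2) + Var 2 ^ 2 * Var 3"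
| "cubic_rest T333 = Var 2 ^ 2 * Var 3 - Var 3 ^ 2 * Var 2"
| "cubic_rest T442 = Var 2 ^ 2 * Var 3 + Var 1 * Var 3 ^ 2"
| "cubic_rest T632 = Var 2 ^ 2 * Var 3 + Var 3 ^ 3"

lemma sub_exponent_add: "sub_exponent T (m + n) = sub_exponent T m + sub_exponent T n"
  by (cases T) (simp_all add: lookup_add single_add distrib_left ac_simps)

lemma weights_simps [simp]:
  "weight [2, 2, 2, 2] 1 = 2" "weight [2, 2, 2, 2] 2 = 2" "weight [2, 2, 2, 2] 3 = 2" "weight [2, 2, 2, 2] 4 = 2"
  "weight [3, 3, 3] 1 = 3" "weight [3, 3, 3] 2 = 3" "weight [3, 3, 3] 3 = 3"
  "weight [4, 4, 2] 1 = 4" "weight [4, 4, 2] 2 = 4" "weight [4, 4, 2] 3 = 2"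
  "weight [6, 3, 2] 1 = 6" "weight [6, 3, 2] 2 = 3" "weight [6, 3, 2] 3 = 2"
  by (simp_all add: weight_def)

lemma index_set_1: "{1..length (weights T)} = (case T of T2222 _ \<Rightarrow> {1, 2, 3, 4} | _ \<Rightarrow> {1, 2, 3})"
  by (cases T) auto

lemma index_set_3: "{3..length (weights T)} = (case T of T2222 _ \<Rightarrow> {3, 4} | _ \<Rightarrow> {3})"
  by (cases T) auto

lemma three_le_length_weights: "3 \<le> length (weights T)"
  by (cases T) auto

lemma weight_weights_pos: "i \<in> {1..length (weights T)} \<Longrightarrow> 0 < weight (weights T) i"
  unfolding index_set_1 by (cases T) (auto simp del: One_nat_def)

locale tubular =
  fixes T :: "'k::field tubular_type"
begin

declare One_nat_def [simp del]

abbreviation t :: nat where "t \<equiv> length (weights T)"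
abbreviation w :: "nat \<Rightarrow> nat" where "w \<equiv> weight (weights T)"
abbreviation size3 :: "exponent \<Rightarrow> int" where
  "size3 m \<equiv> \<Sum>i\<in>{1..3}. int (Poly_Mapping.lookup m i)"

definition Q :: "nat \<Rightarrow> 'k mpoly" where
  "Q i = Var 2 ^ w 2 - Const (lam T i) * Var 1 ^ w 1"

lemma S_relations_eq: "S_relations T = (\<lambda>i. Var i ^ w i - Q i) ` {3..t}"
  unfolding index_set_3 Q_def by (cases T) simp_all

lemma Q_in_poly_alg: "Q i \<in> carrier (poly_alg t)"
  unfolding Q_def using three_le_length_weights[of T] by (intro poly_alg_closed poly_alg_closed_power) auto

text \<open>X^3 has coefficient 1 in type (3,3,3) and -1 in the other types; the generated ideal
  does not see the sign.\<close>

lemma R_relation_cases: "R_relation T = Var 1 ^ 3 - cubic_rest T \<or> R_relation T = - (Var 1 ^ 3 - cubic_rest T)"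
proof -
  have [simp]: "(Var i ^ 3 :: 'k mpoly) = Var i * Var i * Var i" "(Var i ^ 2 :: 'k mpoly) = Var i * Var i" for i
    by (simp_all add: power2_eq_square power3_eq_cube)
  show ?thesis
    by (cases T) (simp_all add: Const_add algebra_simps)
qed

lemma cubic_rest_keys:
  "Poly_Mapping.keys (cubic_rest T) \<subseteq> {m. Poly_Mapping.keys m \<subseteq> {1..3} \<and> Poly_Mapping.lookup m 1 \<le> 2}"
proof -
  let ?M = "{m. Poly_Mapping.keys m \<subseteq> {1..3::nat} \<and> Poly_Mapping.lookup m 1 \<le> (2::nat)}"
  have add: "Poly_Mapping.keys (f + g) \<subseteq> ?M" "Poly_Mapping.keys (f - g) \<subseteq> ?M"
    if "Poly_Mapping.keys f \<subseteq> ?M" "Poly_Mapping.keys g \<subseteq> ?M" for f g :: "'k mpoly"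
    using that Poly_Mapping.keys_add[of f g] keys_diff_subset[of f g] by blast+
  have mult: "Poly_Mapping.keys (Const c * f) \<subseteq> ?M"
    if "Poly_Mapping.keys f \<subseteq> ?M" for f :: "'k mpoly" and c
    using that keys_Const_mult[of c f] by blast
  have two: "Poly_Mapping.keys (Var i ^ a * Var j ^ b :: 'k mpoly) \<subseteq> ?M"
    if "i \<in> {1..3}" "j \<in> {1..3}" "i = 1 \<longrightarrow> a \<le> 2" "j = 1 \<longrightarrow> b \<le> 2" "i \<noteq> j" for i j a b
    using that Poly_Mapping.keys_add[of "Poly_Mapping.single i a" "Poly_Mapping.single j b"]
    by (auto simp: Var_power lookup_add lookup_single when_def split: if_splits simp flip: mon_add)
  have facts: "Poly_Mapping.keys (Var 1 ^ 2 * Var 3 :: 'k mpoly) \<subseteq> ?M" "Poly_Mapping.keys (Var 1 * Var 3 ^ 2 :: 'k mpoly) \<subseteq> ?M"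
    "Poly_Mapping.keys (Var 2 ^ 2 * Var 3 :: 'k mpoly) \<subseteq> ?M" "Poly_Mapping.keys (Var 3 ^ 2 * Var 2 :: 'k mpoly) \<subseteq> ?M"
    "Poly_Mapping.keys (Var 3 ^ 3 :: 'k mpoly) \<subseteq> ?M"
    \<comment> \<open>The exponent 0 in the last instance yields the pure power Z^3.\<close>
    using two[of 1 3 2 1] two[of 1 3 1 2] two[of 2 3 2 1] two[of 3 2 2 1] two[of 2 3 0 3] by simp_all
  show ?thesis
    by (cases T) (simp_all only: cubic_rest.simps add mult facts)
qed

sublocale W: weight_sequence "weights T"
  using three_le_length_weights[of T] by unfold_locales (auto simp: weight_weights_pos)

sublocale S: graded_presentation t "string_degree (weights T)" "S_relations T"
  by unfold_locales (auto simp: S_relations_eq intro!: Q_in_poly_alg)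

sublocale R: graded_presentation 3 size3 "{R_relation T}"
proof unfold_locales
  have "cubic_rest T \<in> carrier (poly_alg 3)"
    using cubic_rest_keys by (auto simp: carrier_poly_alg)
  then show "{R_relation T} \<subseteq> carrier (poly_alg 3)"
    using R_relation_cases by (auto simp del: minus_diff_eq)
qed

text \<open>Division with remainder of the exponents from 3 on: the quotient counts the blocks
  X_i^{p_i} replaced by \<open>Q i\<close>, the remainder stays. Since \<open>Q i\<close> involves
  only X_1 and X_2, a single round of replacements reaches the normal form.\<close>

definition normal_mon :: "exponent \<Rightarrow> 'k mpoly" where
  "normal_mon n =
     mon (Poly_Mapping.single 1 (Poly_Mapping.lookup n 1) + Poly_Mapping.single 2 (Poly_Mapping.lookup n 2)) *
     (\<Prod>i\<in>{3..t}. Q i ^ (Poly_Mapping.lookup n i div w i) *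
        mon (Poly_Mapping.single i (Poly_Mapping.lookup n i mod w i)))"

text \<open>The term of \<open>normal_mon n\<close> of largest degree in \<open>X\<^sub>2\<close>.\<close>

definition lead :: "exponent \<Rightarrow> exponent" where
  "lead n =
     Poly_Mapping.single 1 (Poly_Mapping.lookup n 1) + Poly_Mapping.single 2 (Poly_Mapping.lookup n 2) +
     (\<Sum>i\<in>{3..t}. Poly_Mapping.single 2 (Poly_Mapping.lookup n i div w i * w 2) +
        Poly_Mapping.single i (Poly_Mapping.lookup n i mod w i))"

abbreviation N :: "'k mpoly \<Rightarrow> 'k mpoly" where "N \<equiv> linext normal_mon"

lemma exponent_decomposition:
  assumes "Poly_Mapping.keys n \<subseteq> {1..t}"
  shows "n = Poly_Mapping.single 1 (Poly_Mapping.lookup n 1) + Poly_Mapping.single 2 (Poly_Mapping.lookup n 2) +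
     (\<Sum>i\<in>{3..t}. Poly_Mapping.single i (Poly_Mapping.lookup n i div w i * w i) +
        Poly_Mapping.single i (Poly_Mapping.lookup n i mod w i))"
    (is "n = ?r")
proof (rule poly_mapping_eqI)
  fix j :: nat
  have "{1..t} = {1, 2} \<union> {3..t}"
    using three_le_length_weights[of T] by auto
  then show "Poly_Mapping.lookup n j = Poly_Mapping.lookup ?r j"
    using assms by (auto simp: lookup_add lookup_sum lookup_single when_def in_keys_iff div_mult_mod_eq simp flip: single_add)
qed

text \<open>On a monomial, exchanging X_i^{p_i} for \<open>Q i\<close> is a congruence modulo the
  ideal, and congruences are compatible with powers and products.\<close>

lemma N_cong:
  assumes "f \<in> carrier (poly_alg t)"
  shows "N f \<in> carrier (poly_alg t) \<and> f - N f \<in> S.I"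
  using assms[unfolded carrier_poly_alg]
proof (induction f rule: mpoly_induct)
  case zero
  then show ?case by (simp add: S.I_0)
next
  case (add f g)
  then show ?case
    using S.I_add[of "f - N f" "g - N g"] by (simp add: linext_add add_diff_add)
next
  case (scale c f)
  moreover have "Const c * f - N (Const c * f) = Const c * (f - N f)"
    by (simp add: linext_Const_mult right_diff_distrib)
  ultimately show ?case by (simp add: linext_Const_mult S.I_mult)
next
  case (mon n)
  let ?m = "mon (Poly_Mapping.single 1 (Poly_Mapping.lookup n 1) + Poly_Mapping.single 2 (Poly_Mapping.lookup n 2)) :: 'k mpoly"
  let ?g = "\<lambda>i. (Var i ^ w i) ^ (Poly_Mapping.lookup n i div w i) *
      (mon (Poly_Mapping.single i (Poly_Mapping.lookup n i mod w i)) :: 'k mpoly)"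
  let ?h = "\<lambda>i. Q i ^ (Poly_Mapping.lookup n i div w i) *
      (mon (Poly_Mapping.single i (Poly_Mapping.lookup n i mod w i)) :: 'k mpoly)"
  have "mon n = ?m * (\<Prod>i\<in>{3..t}. ?g i)"
    by (subst exponent_decomposition[of n])
      (use mon in \<open>simp_all only: mon_add mon_sum finite_atLeastAtMost Var_power mon_single_power mem_Collect_eq mult.commute[of "w _"]\<close>)
  moreover have m: "?m \<in> carrier (poly_alg t)"
    using three_le_length_weights[of T] by (simp only: mon_add) auto
  moreover have g: "?g i \<in> carrier (poly_alg t)" and h: "?h i \<in> carrier (poly_alg t)"
    and "?g i - ?h i \<in> S.I" if "i \<in> {3..t}" for i
  proof -
    have i: "Var i ^ w i \<in> carrier (poly_alg t)" "mon (Poly_Mapping.single i (Poly_Mapping.lookup n i mod w i)) \<in> carrier (poly_alg t)"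
      using that by auto
    show "?g i \<in> carrier (poly_alg t)" "?h i \<in> carrier (poly_alg t)"
      using i Q_in_poly_alg by blast+
    have "Var i ^ w i - Q i \<in> S.I"
      using that S.P.genideal_self[OF S.relations] by (auto simp: S_relations_eq)
    then show "?g i - ?h i \<in> S.I"
      using i Q_in_poly_alg by (intro S.I_cong_mult S.I_cong_power) (auto simp: S.I_0)
  qed
  then have "prod ?g {3..t} - prod ?h {3..t} \<in> S.I"
    by (intro S.I_cong_prod) auto
  ultimately have "mon n - ?m * prod ?h {3..t} \<in> S.I"
    using S.I_mult[of ?m "prod ?g {3..t} - prod ?h {3..t}"] by (simp add: right_diff_distrib)
  moreover have "prod ?h {3..t} \<in> carrier (poly_alg t)"
    by (rule poly_alg_closed_prod) (rule h)
  then have "?m * prod ?h {3..t} \<in> carrier (poly_alg t)"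
    by (rule poly_alg_closed(7)[OF m])
  ultimately show ?case
    by (simp add: normal_mon_def)
qed

lemma normal_mon_add_12:
  assumes "j \<in> {1, 2}"
  shows "normal_mon (n + Poly_Mapping.single j a) = mon (Poly_Mapping.single j a) * normal_mon n"
proof -
  have "(\<Prod>i\<in>{3..t}. Q i ^ (Poly_Mapping.lookup (n + Poly_Mapping.single j a) i div w i) *
        mon (Poly_Mapping.single i (Poly_Mapping.lookup (n + Poly_Mapping.single j a) i mod w i))) =
      (\<Prod>i\<in>{3..t}. Q i ^ (Poly_Mapping.lookup n i div w i) *
        mon (Poly_Mapping.single i (Poly_Mapping.lookup n i mod w i)))"
    using assms by (intro prod.cong) (auto simp: lookup_add lookup_single when_def)
  then show ?thesis
    using assms unfolding normal_mon_def
    by (auto simp: lookup_add lookup_single when_def single_add mon_add ac_simps)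
qed

lemma normal_mon_add_weight:
  assumes "j \<in> {3..t}"
  shows "normal_mon (n + Poly_Mapping.single j (w j)) = Q j * normal_mon n"
proof -
  let ?g = "\<lambda>n i. Q i ^ (Poly_Mapping.lookup n i div w i) *
      (mon (Poly_Mapping.single i (Poly_Mapping.lookup n i mod w i)) :: 'k mpoly)"
  let ?n = "n + Poly_Mapping.single j (w j)"
  have "0 < w j"
    using assms by (intro weight_weights_pos) auto
  then have "?g ?n j = Q j * ?g n j"
    by (simp add: lookup_add power_add ac_simps)
  moreover have "prod (?g ?n) ({3..t} - {j}) = prod (?g n) ({3..t} - {j})"
    by (intro prod.cong) (auto simp: lookup_add lookup_single when_def)
  ultimately have "prod (?g ?n) {3..t} = Q j * prod (?g n) {3..t}"
    using assms by (simp only: prod.remove[of "{3..t}" j] finite_atLeastAtMost mult.assoc)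
  moreover have "Poly_Mapping.lookup ?n 1 = Poly_Mapping.lookup n 1" "Poly_Mapping.lookup ?n 2 = Poly_Mapping.lookup n 2"
    using assms by (auto simp: lookup_add lookup_single when_def)
  ultimately show ?thesis
    unfolding normal_mon_def by (simp only: mult.left_commute)
qed

text \<open>\<open>normal_mon\<close> turns multiplication by X_j^{p_j} into multiplication by
  \<open>Q j\<close>. It commutes with multiplication by powers of X_1 and X_2, hence with
  \<open>Q j\<close> itself, so both terms of the relation contribute the same.\<close>

lemma N_relation:
  assumes "j \<in> {3..t}"
  shows "N (f * (Var j ^ w j - Q j)) = 0"
  using subset_UNIV
proof (induction f rule: mpoly_induct)
  case (mon n)
  have "mon n * (Var j ^ w j - Q j) = mon (n + Poly_Mapping.single j (w j)) -
      (mon (n + Poly_Mapping.single 2 (w 2)) - Const (lam T j) * mon (n + Poly_Mapping.single 1 (w 1)))"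
    by (simp add: Q_def Var_power mon_add algebra_simps)
  then show ?case
    using assms
    by (simp add: linext_diff linext_Const_mult normal_mon_add_weight normal_mon_add_12)
      (simp add: Q_def Var_power algebra_simps)
qed (simp_all add: distrib_right linext_add mult.assoc linext_Const_mult)

lemma N_I: "f \<in> S.I \<Longrightarrow> N f = 0"
  by (rule S.I_induct_vanishing[where L = N])
    (auto simp: linext_add linext_uminus S_relations_eq N_relation)

text \<open>\<open>f - N f\<close> always lies in the ideal, and \<open>N\<close> vanishes on the
  ideal.\<close>

lemma in_S_I_iff: "f \<in> carrier (poly_alg t) \<Longrightarrow> f \<in> S.I \<longleftrightarrow> N f = 0"
  using N_cong[of f] N_I[of f] by auto

end

section \<open>Elementary arithmetic of exponents\<close>

lemma congruent_mod_3:
  fixes a b :: nat and x :: int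
  assumes "int a - int b = 3 * x" "b \<le> 2"
  obtains l where "a = b + 3 * l"
proof
  \<comment> \<open>A negative \<open>x\<close> would give \<open>b\<close> at least 3.\<close>
  have "0 \<le> x"
    using assms by linarith
  then show "a = b + 3 * nat x"
    using assms(1) by linarith
qed

text \<open>With j = 2q + c one has j + 4 (j div 2) = c + 6q, so (b - c)/2 = 3q + i, and division by
  3 yields q and i. The condition on the sum then makes a - i the multiple 3 (k - i - j). The same
  equations serve types (2,2,2,2) and (4,4,2).\<close>

lemma lead_arith:
  fixes a b c :: nat and k :: int
  assumes sum: "int a + int b + 2 * int c = 3 * k" and par: "even (b + c)" "c < 2"
  shows "\<exists>i j l. a = i + 3 * l \<and> b = 2 * i + j + j div 2 * 4 \<and> c = j mod 2 \<and> int i + int j + int l = k"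
proof -
  have "c \<le> b"
    using par by presburger
  define d where "d = (b - c) div 2"
  have "even (b - c)"
    using par by simp
  then have "b = c + 2 * d"
    using \<open>c \<le> b\<close> by (auto simp: d_def)
  moreover obtain q i where "d = 3 * q + i" "i \<le> 2"
    by (rule that[of "d div 3" "d mod 3"]) auto
  ultimately have b: "b = c + 6 * q + 2 * i" and "i \<le> 2"
    by auto
  with sum have "int a - int i = 3 * (k - int c - 2 * int q - int i)"
    by (simp add: algebra_simps)
  then obtain l where "a = i + 3 * l"
    using congruent_mod_3 \<open>i \<le> 2\<close> by blast
  then show ?thesis
    using b sum par by (intro exI[of _ i] exI[of _ "2 * q + c"] exI[of _ l]) auto
qed

lemma base_3_unique:
  fixes a q a' q' :: nat
  assumes "a + 3 * q = a' + 3 * q'" "a \<le> 2" "a' \<le> 2"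
  shows "a = a' \<and> q = q'"
proof -
  have "(a + 3 * q) mod 3 = a" "(a' + 3 * q') mod 3 = a'"
    using assms(2,3) by auto
  with assms(1) show ?thesis by auto
qed

text \<open>2a + b + 4 (b div 2) equals 2 (a + 3 (b div 2)) + b mod 2. Once the parity of b is
  known, a is the lowest base 3 digit of the bracket.\<close>

lemma lead_arith_inj:
  fixes a b a' b' :: nat
  assumes "2 * a + b + b div 2 * 4 = 2 * a' + b' + b' div 2 * 4" "b mod 2 = b' mod 2" "a \<le> 2" "a' \<le> 2"
  shows "a = a' \<and> b = b'"
proof -
  have "b = 2 * (b div 2) + b mod 2" "b' = 2 * (b' div 2) + b' mod 2"
    by simp_all
  with assms have "a + 3 * (b div 2) = a' + 3 * (b' div 2)"
    by linarith
  then have "a = a' \<and> b div 2 = b' div 2"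
    using assms(3,4) by (rule base_3_unique)
  with assms(2) show ?thesis by (metis div_mult_mod_eq)
qed

section \<open>Leading terms with respect to the degree in X_2\<close>

context tubular
begin

text \<open>Every lower term arises from the leading monomial \<open>n\<close> by trading
  \<open>s\<close> blocks X_2^{p_2} for X_1^{p_1}. Recording the trade, and not just a drop of the
  degree in X_2, also keeps control of the other exponents. Both sides are sums because subtraction
  of exponents truncates.\<close>

definition triangular :: "exponent \<Rightarrow> 'k mpoly \<Rightarrow> bool" where
  "triangular n f \<longleftrightarrow> (\<forall>m\<in>Poly_Mapping.keys (f - mon n). \<exists>s>0.
     m + Poly_Mapping.single 2 (s * w 2) = n + Poly_Mapping.single 1 (s * w 1))"

lemma w_pos: "0 < w 2"
  using three_le_length_weights[of T] by (intro weight_weights_pos) auto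

lemma triangular_mon: "triangular n (mon n)"
  by (simp add: triangular_def)

text \<open>Numbers of traded blocks add up, with 0 for a leading term; every product other than
  leading times leading therefore trades a positive number.\<close>

lemma triangular_mult:
  assumes f: "triangular n f" and g: "triangular n' g"
  shows "triangular (n + n') (f * g)"
  unfolding triangular_def
proof
  fix m assume m: "m \<in> Poly_Mapping.keys (f * g - mon (n + n'))"
  let ?r = "f - mon n" and ?r' = "g - mon n'"
  have "f * g - mon (n + n') = mon n * ?r' + (?r * mon n' + ?r * ?r')"
    by (simp add: algebra_simps mon_add)
  then have "m \<in> Poly_Mapping.keys (mon n * ?r') \<union> (Poly_Mapping.keys (?r * mon n') \<union> Poly_Mapping.keys (?r * ?r'))"
    using m Poly_Mapping.keys_add[of "mon n * ?r'" "?r * mon n' + ?r * ?r'"]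
      Poly_Mapping.keys_add[of "?r * mon n'" "?r * ?r'"] by auto
  then consider b where "m = n + b" "b \<in> Poly_Mapping.keys ?r'"
    | a where "m = a + n'" "a \<in> Poly_Mapping.keys ?r"
    | a b where "m = a + b" "a \<in> Poly_Mapping.keys ?r" "b \<in> Poly_Mapping.keys ?r'"
    using keys_mult[of "mon n" ?r'] keys_mult[of ?r "mon n'"] keys_mult[of ?r ?r'] by auto
  then show "\<exists>s>0. m + Poly_Mapping.single 2 (s * w 2) = n + n' + Poly_Mapping.single 1 (s * w 1)"
  proof cases
    case 1
    then obtain s where "s > 0" "b + Poly_Mapping.single 2 (s * w 2) = n' + Poly_Mapping.single 1 (s * w 1)"
      using g by (auto simp: triangular_def)
    with 1 show ?thesis by (intro exI[of _ s]) (simp add: add.assoc)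
  next
    case 2
    then obtain s where s: "s > 0" "a + Poly_Mapping.single 2 (s * w 2) = n + Poly_Mapping.single 1 (s * w 1)"
      using f by (auto simp: triangular_def)
    have "m + Poly_Mapping.single 2 (s * w 2) = a + Poly_Mapping.single 2 (s * w 2) + n'"
      using 2 by (simp add: ac_simps)
    with s show ?thesis by (intro exI[of _ s]) (simp add: ac_simps)
  next
    case 3
    then obtain s s' where s: "s > 0" "a + Poly_Mapping.single 2 (s * w 2) = n + Poly_Mapping.single 1 (s * w 1)"
      and s': "s' > 0" "b + Poly_Mapping.single 2 (s' * w 2) = n' + Poly_Mapping.single 1 (s' * w 1)"
      using f g unfolding triangular_def by blast
    have "m + Poly_Mapping.single 2 ((s + s') * w 2) =
        (a + Poly_Mapping.single 2 (s * w 2)) + (b + Poly_Mapping.single 2 (s' * w 2))"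
      using 3 by (simp add: single_add distrib_right ac_simps)
    also have "\<dots> = n + n' + Poly_Mapping.single 1 ((s + s') * w 1)"
      unfolding s s' by (simp add: single_add distrib_right ac_simps)
    finally show ?thesis using s by (intro exI[of _ "s + s'"]) simp
  qed
qed

lemma triangular_Q: "triangular (Poly_Mapping.single 2 (w 2)) (Q i)"
proof -
  have "Q i - mon (Poly_Mapping.single 2 (w 2)) = Const (- lam T i) * mon (Poly_Mapping.single 1 (w 1))"
    by (simp add: Q_def Var_power Const_uminus)
  moreover have "Poly_Mapping.keys \<dots> \<subseteq> {Poly_Mapping.single 1 (w 1)}"
    using keys_Const_mult[of "- lam T i" "mon (Poly_Mapping.single 1 (w 1))"] by simp
  ultimately show ?thesis
    unfolding triangular_def by (auto intro!: exI[of _ 1] simp: add.commute)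
qed

lemma triangular_power: "triangular (Poly_Mapping.single 2 b) f \<Longrightarrow> triangular (Poly_Mapping.single 2 (a * b)) (f ^ a)"
proof (induction a)
  case 0
  then show ?case using triangular_mon[of 0] by simp
next
  case (Suc a)
  then show ?case using triangular_mult[of "Poly_Mapping.single 2 b" f "Poly_Mapping.single 2 (a * b)" "f ^ a"]
    by (simp add: single_add)
qed

lemma triangular_prod:
  "finite J \<Longrightarrow> (\<And>i. i \<in> J \<Longrightarrow> triangular (n i) (f i)) \<Longrightarrow> triangular (sum n J) (prod f J)"
proof (induction J rule: finite_induct)
  case empty
  then show ?case using triangular_mon[of 0] by simp
qed (simp add: triangular_mult)

lemma triangular_normal_mon: "triangular (lead n) (normal_mon n)"
  unfolding lead_def normal_mon_def
  by (intro triangular_mult triangular_prod triangular_mon triangular_power triangular_Q) auto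

lemma triangular_keys:
  assumes "triangular n f" "m \<in> Poly_Mapping.keys f" "m \<noteq> n"
  obtains s where "s > 0" "m + Poly_Mapping.single 2 (s * w 2) = n + Poly_Mapping.single 1 (s * w 1)"
proof -
  have "m \<in> Poly_Mapping.keys (f - mon n)"
    using assms by (simp add: in_keys_iff lookup_minus lookup_single_not_eq)
  then show ?thesis
    using assms(1) that unfolding triangular_def by blast
qed

lemma triangular_less:
  assumes "triangular n f" "m \<in> Poly_Mapping.keys (f - mon n)"
  shows "Poly_Mapping.lookup m 2 < Poly_Mapping.lookup n 2"
proof -
  obtain s where "s > 0" "m + Poly_Mapping.single 2 (s * w 2) = n + Poly_Mapping.single 1 (s * w 1)"
    using assms unfolding triangular_def by blast
  moreover from arg_cong[OF this(2), of "\<lambda>v. Poly_Mapping.lookup v 2"]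
  have "Poly_Mapping.lookup m 2 + s * w 2 = Poly_Mapping.lookup n 2"
    by (simp add: lookup_add lookup_single)
  moreover have "0 < s * w 2"
    using w_pos \<open>s > 0\<close> by simp
  ultimately show ?thesis by linarith
qed

lemma triangular_lookup:
  assumes "triangular n f"
  shows "Poly_Mapping.lookup f n = 1"
proof -
  have "n \<notin> Poly_Mapping.keys (f - mon n)"
    using triangular_less[OF assms, of n] by auto
  then show ?thesis
    by (simp add: in_keys_iff lookup_minus)
qed

lemma lookup_lead:
  "Poly_Mapping.lookup (lead n) 1 = Poly_Mapping.lookup n 1"
  "Poly_Mapping.lookup (lead n) 2 = Poly_Mapping.lookup n 2 + (\<Sum>i\<in>{3..t}. Poly_Mapping.lookup n i div w i * w 2)"
  "i \<in> {3..t} \<Longrightarrow> Poly_Mapping.lookup (lead n) i = Poly_Mapping.lookup n i mod w i"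
  by (auto simp: lead_def lookup_add lookup_sum lookup_single when_def sum.distrib)

text \<open>Trades touch X_1 and X_2 only, so every term has the exponents of \<open>lead n\<close>
  from 3 on, and these are remainders modulo the weights.\<close>

lemma keys_normal_mon_reduced:
  assumes "m \<in> Poly_Mapping.keys (normal_mon n)" "i \<in> {3..t}"
  shows "Poly_Mapping.lookup m i < w i"
proof -
  have "Poly_Mapping.lookup m i = Poly_Mapping.lookup (lead n) i"
  proof (cases "m = lead n")
    case False
    then obtain s where "m + Poly_Mapping.single 2 (s * w 2) = lead n + Poly_Mapping.single 1 (s * w 1)"
      using triangular_keys[OF triangular_normal_mon assms(1)] by blast
    from arg_cong[OF this, of "\<lambda>v. Poly_Mapping.lookup v i"] show ?thesis
      using assms(2) by (simp add: lookup_add lookup_single)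
  qed simp
  moreover have "0 < w i"
    using assms(2) by (intro weight_weights_pos) auto
  ultimately show ?thesis
    using assms(2) by (simp add: lookup_lead)
qed

section \<open>Normal forms preserve the degree in the string group\<close>

definition same_degree :: "exponent \<Rightarrow> 'k mpoly \<Rightarrow> bool" where
  "same_degree n f \<longleftrightarrow> (\<forall>m\<in>Poly_Mapping.keys f. W.vec m - W.vec n \<in> string_relations (weights T))"

lemma same_degree_mon: "same_degree n (mon n)"
  by (simp add: same_degree_def W.string_relations_0)

lemma same_degree_mult:
  assumes "same_degree n f" "same_degree n' g"
  shows "same_degree (n + n') (f * g)"
  unfolding same_degree_def
proof
  fix m assume "m \<in> Poly_Mapping.keys (f * g)"
  then obtain a b where ab: "m = a + b" "a \<in> Poly_Mapping.keys f" "b \<in> Poly_Mapping.keys g"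
    using keys_mult[of f g] by blast
  then have "W.vec m - W.vec (n + n') = (W.vec a - W.vec n) + (W.vec b - W.vec n')"
    by (simp add: W.vec_add)
  then show "W.vec m - W.vec (n + n') \<in> string_relations (weights T)"
    using assms ab by (auto simp: same_degree_def intro: W.string_relations_add)
qed

text \<open>X_i^{p_i}, X_1^{p_1} and X_2^{p_2} all have degree c.\<close>

lemma same_degree_Q:
  assumes "i \<in> {1..t}"
  shows "same_degree (Poly_Mapping.single i (w i)) (Q i)"
proof -
  have "Poly_Mapping.keys (Q i) \<subseteq> {Poly_Mapping.single 2 (w 2), Poly_Mapping.single 1 (w 1)}"
    using keys_diff_subset[of "Var 2 ^ w 2" "Const (lam T i) * Var 1 ^ w 1"]
      keys_Const_mult[of "lam T i" "Var 1 ^ w 1"] by (auto simp: Q_def Var_power)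
  moreover have "1 \<in> {1..t}" "2 \<in> {1..t}"
    using three_le_length_weights[of T] by auto
  ultimately show ?thesis
    unfolding same_degree_def using assms W.relation_in_string_relations by blast
qed

lemma same_degree_power: "same_degree (Poly_Mapping.single i b) f \<Longrightarrow> same_degree (Poly_Mapping.single i (a * b)) (f ^ a)"
proof (induction a)
  case 0
  then show ?case using same_degree_mon[of 0] by simp
next
  case (Suc a)
  then show ?case using same_degree_mult[of "Poly_Mapping.single i b" f "Poly_Mapping.single i (a * b)" "f ^ a"]
    by (simp add: single_add)
qed

lemma same_degree_prod:
  "finite J \<Longrightarrow> (\<And>i. i \<in> J \<Longrightarrow> same_degree (n i) (f i)) \<Longrightarrow> same_degree (sum n J) (prod f J)"
proof (induction J rule: finite_induct)
  case empty
  then show ?case using same_degree_mon[of 0] by simp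
qed (simp add: same_degree_mult)

lemma same_degree_normal_mon:
  assumes "Poly_Mapping.keys n \<subseteq> {1..t}"
  shows "same_degree n (normal_mon n)"
  unfolding normal_mon_def
  by (subst exponent_decomposition[OF assms])
    (intro same_degree_mult same_degree_prod same_degree_mon same_degree_power same_degree_Q, auto)

lemma H_exponent_normal_mon:
  assumes "Poly_Mapping.keys n \<subseteq> {1..t}" "m \<in> Poly_Mapping.keys (normal_mon n)"
  shows "W.H_exponent k m \<longleftrightarrow> W.H_exponent k n"
  using same_degree_normal_mon[OF assms(1)] assms(2)
  by (intro W.H_exponent_cong) (auto simp: same_degree_def)

lemma keys_sub_exponent: "Poly_Mapping.keys (sub_exponent T m) \<subseteq> {1..t}"
  unfolding index_set_1
  by (cases T) (auto simp: in_keys_iff lookup_add lookup_single when_def split: if_splits)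

text \<open>Obtained indirectly: \<open>lead n\<close> occurs in \<open>normal_mon n\<close>, which
  is known to involve only X_1, ..., X_t.\<close>

lemma keys_lead:
  assumes "Poly_Mapping.keys n \<subseteq> {1..t}"
  shows "Poly_Mapping.keys (lead n) \<subseteq> {1..t}"
proof -
  have "Poly_Mapping.lookup (normal_mon n) (lead n) = 1"
    using triangular_lookup[OF triangular_normal_mon] .
  then have "lead n \<in> Poly_Mapping.keys (normal_mon n)"
    by (simp add: in_keys_iff)
  moreover have "normal_mon n \<in> carrier (poly_alg t)"
    using N_cong[of "mon n"] assms by simp
  ultimately show ?thesis
    by (auto simp: carrier_poly_alg)
qed

section \<open>Leading monomials of the images of the monomials of \<open>R\<close>\<close>

lemma size3_eq:
  "size3 m = int (Poly_Mapping.lookup m 1) + int (Poly_Mapping.lookup m 2) + int (Poly_Mapping.lookup m 3)"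
proof -
  have "{1..3} = {1, 2, 3 :: nat}" by auto
  then show ?thesis by simp
qed

text \<open>Let a and b be the exponents of X and Y. In type (2,2,2,2) each of X_3^b and X_4^b
  yields b div 2 factors X_2^2, in type (4,4,2) X_3^b alone yields b div 2 factors X_2^4; hence the
  common summand 4 (b div 2). In type (6,3,2) the factors are X_2^3, and in type (3,3,3) the power
  to be reduced is X_3^a, coming from x^a.\<close>

lemma lookup_lead_sub_exponent:
  "Poly_Mapping.lookup (lead (sub_exponent T m)) 1 = Poly_Mapping.lookup m 1 + 3 * Poly_Mapping.lookup m 3"
  "Poly_Mapping.lookup (lead (sub_exponent T m)) 2 = (case T of
     T333 \<Rightarrow> Poly_Mapping.lookup m 1 + 3 * Poly_Mapping.lookup m 2 + Poly_Mapping.lookup m 1 div 3 * 3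
   | T632 \<Rightarrow> Poly_Mapping.lookup m 1 + Poly_Mapping.lookup m 2 div 2 * 3
   | _ \<Rightarrow> 2 * Poly_Mapping.lookup m 1 + Poly_Mapping.lookup m 2 + Poly_Mapping.lookup m 2 div 2 * 4)"
  "Poly_Mapping.lookup (lead (sub_exponent T m)) 3 =
     (case T of T333 \<Rightarrow> Poly_Mapping.lookup m 1 mod 3 | _ \<Rightarrow> Poly_Mapping.lookup m 2 mod 2)"
  "T = T2222 l \<Longrightarrow> Poly_Mapping.lookup (lead (sub_exponent T m)) 4 = Poly_Mapping.lookup m 2 mod 2"
proof -
  have 3: "3 \<in> {3..t}"
    using three_le_length_weights[of T] by simp
  show "Poly_Mapping.lookup (lead (sub_exponent T m)) 1 = Poly_Mapping.lookup m 1 + 3 * Poly_Mapping.lookup m 3"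
    unfolding lookup_lead by (cases T) (simp_all add: lookup_add lookup_single)
  show "Poly_Mapping.lookup (lead (sub_exponent T m)) 2 = (case T of
     T333 \<Rightarrow> Poly_Mapping.lookup m 1 + 3 * Poly_Mapping.lookup m 2 + Poly_Mapping.lookup m 1 div 3 * 3
   | T632 \<Rightarrow> Poly_Mapping.lookup m 1 + Poly_Mapping.lookup m 2 div 2 * 3
   | _ \<Rightarrow> 2 * Poly_Mapping.lookup m 1 + Poly_Mapping.lookup m 2 + Poly_Mapping.lookup m 2 div 2 * 4)"
    unfolding lookup_lead index_set_3 by (cases T) (simp_all add: lookup_add lookup_single)
  show "Poly_Mapping.lookup (lead (sub_exponent T m)) 3 =
     (case T of T333 \<Rightarrow> Poly_Mapping.lookup m 1 mod 3 | _ \<Rightarrow> Poly_Mapping.lookup m 2 mod 2)"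
    unfolding lookup_lead(3)[OF 3] by (cases T) (simp_all add: lookup_add lookup_single)
  assume T: "T = T2222 l"
  then have 4: "4 \<in> {3..t}" by simp
  show "Poly_Mapping.lookup (lead (sub_exponent T m)) 4 = Poly_Mapping.lookup m 2 mod 2"
    unfolding lookup_lead(3)[OF 4] using T by (simp add: lookup_add lookup_single)
qed

text \<open>The exponents of X_2 and X_3 determine those of X and Y, thanks to the bound on X; the
  exponent of X_1 then gives that of Z.\<close>

lemma lead_sub_exponent_inj:
  assumes "Poly_Mapping.keys m \<subseteq> {1..3}" "Poly_Mapping.keys m' \<subseteq> {1..3}"
    and le: "Poly_Mapping.lookup m 1 \<le> 2" "Poly_Mapping.lookup m' 1 \<le> 2"
    and eq: "lead (sub_exponent T m) = lead (sub_exponent T m')"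
  shows "m = m'"
proof (rule exponent_eqI[OF assms(1,2)])
  note lookups = lookup_lead_sub_exponent(1-3)[of m, unfolded eq lookup_lead_sub_exponent(1-3)[of m']]
  have two: "Poly_Mapping.lookup m 1 = Poly_Mapping.lookup m' 1 \<and> Poly_Mapping.lookup m 2 = Poly_Mapping.lookup m' 2"
  proof (cases T)
    case T333
    then have "Poly_Mapping.lookup m 1 = Poly_Mapping.lookup m' 1"
      using lookups(3) le by simp
    then show ?thesis using lookups(2) T333 by simp
  next
    case T632
    have "Poly_Mapping.lookup m 1 + 3 * (Poly_Mapping.lookup m 2 div 2) =
        Poly_Mapping.lookup m' 1 + 3 * (Poly_Mapping.lookup m' 2 div 2)"
      and mod: "Poly_Mapping.lookup m 2 mod 2 = Poly_Mapping.lookup m' 2 mod 2"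
      using lookups(2,3) T632 by simp_all
    from base_3_unique[OF this(1) le]
    show ?thesis
      using mod div_mult_mod_eq[of "Poly_Mapping.lookup m 2" 2] div_mult_mod_eq[of "Poly_Mapping.lookup m' 2" 2]
      by linarith
  next
    case T442
    show ?thesis
      by (rule lead_arith_inj[OF lookups(2,3)[symmetric, unfolded T442 tubular_type.case] le])
  next
    case (T2222 l)
    show ?thesis
      by (rule lead_arith_inj[OF lookups(2,3)[symmetric, unfolded T2222 tubular_type.case] le])
  qed
  moreover have "Poly_Mapping.lookup m 3 = Poly_Mapping.lookup m' 3"
    using lookups(1) two by linarith
  moreover fix i :: nat assume "i \<in> {1..3}"
  then have "i = 1 \<or> i = 2 \<or> i = 3" by auto
  ultimately show "Poly_Mapping.lookup m i = Poly_Mapping.lookup m' i" by auto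
qed

lemma H_exponent_sub_exponent: "W.H_exponent (size3 m) (sub_exponent T m)"
proof -
  let ?a = "int (Poly_Mapping.lookup m 1)" and ?b = "int (Poly_Mapping.lookup m 2)"
  have ex: "\<exists>e c. P e c" if "P (fst ec) (snd ec)" for P :: "int \<Rightarrow> (nat \<Rightarrow> int) \<Rightarrow> bool" and ec
    using that by blast
  show ?thesis
    unfolding W.H_exponent_iff index_set_1 size3_eq
    \<comment> \<open>The first components encode degrees. z has degree 3 x_1; x and y have degrees
      3 x_1 and 3 x_1 + omega in type (2,2,2,2), 3 x_1 - omega and 3 x_1 in type (3,3,3), 3 x_1 + 2
      omega and 3 x_1 + 3 omega in the last two types. The functions are the quotients that solve
      the resulting equations.\<close>
    by (rule ex[of _ "case T of
        T2222 _ \<Rightarrow> (?b, (\<lambda>_. ?b)(1 := - ?a - 3 * ?b, 2 := ?a + ?b))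
      | T333 \<Rightarrow> (- ?a, (\<lambda>_. 0)(1 := - ?b, 2 := ?b))
      | T442 \<Rightarrow> (2 * ?a + 3 * ?b, (\<lambda>_. ?a + 2 * ?b)(1 := - 2 * ?a - 3 * ?b, 2 := ?a + ?b))
      | T632 \<Rightarrow> (2 * ?a + 3 * ?b, (\<lambda>_. ?a + 2 * ?b)(1 := - 2 * ?a - 3 * ?b, 2 := ?a + ?b))"], cases T)
      (simp_all add: lookup_add lookup_single)
qed

text \<open>Multiplying equation i by p_1/p_i and adding eliminates \<open>e\<close> and all
  \<open>c i\<close>: this is the degree map of L(p), which vanishes on omega in tubular type. The
  resulting equation, together with congruences modulo 2 or 3, is solved for the exponents i, j, l
  of X, Y, Z.\<close>

lemma ex_sub_exponent:
  assumes keys: "Poly_Mapping.keys n \<subseteq> {1..t}" and red: "\<And>i. i \<in> {3..t} \<Longrightarrow> Poly_Mapping.lookup n i < w i"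
    and H: "W.H_exponent k n"
  obtains m where "Poly_Mapping.keys m \<subseteq> {1..3}" "lead (sub_exponent T m) = n" "size3 m = k"
proof -
  let ?a = "Poly_Mapping.lookup n 1" and ?b = "Poly_Mapping.lookup n 2" and ?c = "Poly_Mapping.lookup n 3"
  obtain e c where e: "\<forall>i\<in>{1..t}. int (Poly_Mapping.lookup n i) + e =
      int (w i) * c i + (if i = 1 then 3 * k + e * (int t - 2) * int (w 1) else 0)"
    "(\<Sum>i\<in>{1..t}. c i) = 0"
    using H unfolding W.H_exponent_iff by blast
  note e = e[unfolded index_set_1]
  note red = red[unfolded index_set_3]
  have "\<exists>i j l. int i + int j + int l = k \<and> ?a = i + 3 * l \<and>
     ?b = (case T of T333 \<Rightarrow> i + 3 * j + i div 3 * 3 | T632 \<Rightarrow> i + j div 2 * 3 | _ \<Rightarrow> 2 * i + j + j div 2 * 4) \<and>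
     ?c = (case T of T333 \<Rightarrow> i mod 3 | _ \<Rightarrow> j mod 2) \<and>
     (case T of T2222 _ \<Rightarrow> Poly_Mapping.lookup n 4 = j mod 2 | _ \<Rightarrow> True)"
  proof (cases T)
    case (T2222 l)
    have eqs: "int ?a + e = 2 * c 1 + 3 * k + 4 * e" "int ?b + e = 2 * c 2" "int ?c + e = 2 * c 3"
      "int (Poly_Mapping.lookup n 4) + e = 2 * c 4" "c 1 + c 2 + c 3 + c 4 = 0"
      and lt: "?c < 2" "Poly_Mapping.lookup n 4 < 2"
      using e red[of 3] red[of 4] T2222 by simp_all
    \<comment> \<open>Both exponents are less than 2 and congruent to \<open>e\<close> modulo
      2.\<close>
    from eqs(3,4) lt have "Poly_Mapping.lookup n 4 = ?c"
      by presburger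
    moreover from eqs(2,3) have "even (?b + ?c)"
      by presburger
    moreover have "int ?a + int ?b + 2 * int ?c = 3 * k"
      using eqs \<open>Poly_Mapping.lookup n 4 = ?c\<close> by linarith
    ultimately show ?thesis
      using lead_arith[of ?a ?b ?c k] red[of 3] T2222 by auto
  next
    case T333
    have eqs: "int ?a + e = 3 * c 1 + 3 * k + 3 * e" "int ?b + e = 3 * c 2" "int ?c + e = 3 * c 3"
      "c 1 + c 2 + c 3 = 0" and lt: "?c < 3"
      using e red[of 3] T333 by simp_all
    then have *: "int ?a + int ?b + int ?c = 3 * k"
      by linarith
    \<comment> \<open>Since \<open>?c\<close> is at most 2, the choice is i = \<open>?c\<close>; it
      remains to see that \<open>?a\<close> and \<open>?b\<close> exceed it by multiples of
      3.\<close>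
    have "int ?a - int ?c = 3 * (c 1 + k + e - c 3)"
      using eqs by (simp add: algebra_simps)
    moreover have "int ?b - int ?c = 3 * (c 2 - c 3)"
      using eqs by (simp add: algebra_simps)
    moreover have "?c \<le> 2"
      using lt by linarith
    ultimately obtain l j where "?a = ?c + 3 * l" "?b = ?c + 3 * j"
      using congruent_mod_3 by metis
    then show ?thesis
      using * T333 red[of 3] by (intro exI[of _ ?c] exI[of _ j] exI[of _ l]) simp
  next
    case T442
    have eqs: "int ?a + e = 4 * c 1 + 3 * k + 4 * e" "int ?b + e = 4 * c 2" "int ?c + e = 2 * c 3"
      "c 1 + c 2 + c 3 = 0"
      using e T442 by simp_all
    from eqs(2,3) have "even (?b + ?c)"
      by presburger
    moreover have "int ?a + int ?b + 2 * int ?c = 3 * k"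
      using eqs by linarith
    ultimately show ?thesis
      using lead_arith[of ?a ?b ?c k] red[of 3] T442 by auto
  next
    case T632
    have eqs: "int ?a + e = 6 * c 1 + 3 * k + 6 * e" "int ?b + e = 3 * c 2" "int ?c + e = 2 * c 3"
      "c 1 + c 2 + c 3 = 0"
      using e T632 by simp_all
    then have *: "int ?a + 2 * int ?b + 3 * int ?c = 3 * k"
      by linarith
    \<comment> \<open>The shape \<open>?b\<close> = i + 3 (j div 2) and \<open>?c\<close> = j mod 2,
      with i at most 2, leads to i = \<open>?b mod 3\<close> and j = 2 (\<open>?b div 3\<close>) +
      \<open>?c\<close>.\<close>
    have "int ?b = int (?b mod 3 + 3 * (?b div 3))"
      by (simp only: mod_mult_div_eq)
    then have "int ?b = int (?b mod 3) + 3 * int (?b div 3)"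
      by (simp only: of_nat_add of_nat_mult of_nat_numeral)
    with eqs(1,2) have "int ?a - int (?b mod 3) = 3 * (2 * c 1 + k + 2 * e - c 2 + int (?b div 3))"
      by (simp add: algebra_simps)
    then obtain l where l: "?a = ?b mod 3 + 3 * l"
      by (rule congruent_mod_3) simp
    moreover have "?b = ?b mod 3 + 3 * (?b div 3)"
      by simp
    ultimately have "int (?b mod 3) + int (2 * (?b div 3) + ?c) + int l = k"
      using * by linarith
    then show ?thesis
      using l T632 red[of 3] by (intro exI[of _ "?b mod 3"] exI[of _ "2 * (?b div 3) + ?c"] exI[of _ l]) simp
  qed
  then obtain i j l where ijl: "int i + int j + int l = k" "?a = i + 3 * l"
     "?b = (case T of T333 \<Rightarrow> i + 3 * j + i div 3 * 3 | T632 \<Rightarrow> i + j div 2 * 3 | _ \<Rightarrow> 2 * i + j + j div 2 * 4)"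
     "?c = (case T of T333 \<Rightarrow> i mod 3 | _ \<Rightarrow> j mod 2)"
     "case T of T2222 _ \<Rightarrow> Poly_Mapping.lookup n 4 = j mod 2 | _ \<Rightarrow> True"
    by blast
  define m :: exponent where "m = Poly_Mapping.single 1 i + Poly_Mapping.single 2 j + Poly_Mapping.single 3 l"
  have m: "Poly_Mapping.lookup m 1 = i" "Poly_Mapping.lookup m 2 = j" "Poly_Mapping.lookup m 3 = l"
    by (simp_all add: m_def lookup_add lookup_single)
  show ?thesis
  proof
    show "Poly_Mapping.keys m \<subseteq> {1..3}"
      by (auto simp: m_def in_keys_iff lookup_add lookup_single when_def split: if_splits)
    show "lead (sub_exponent T m) = n"
    proof (rule exponent_eqI[OF keys_lead[OF keys_sub_exponent] keys])
      note lookups = lookup_lead_sub_exponent[where m = m, unfolded m]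
      fix x assume "x \<in> {1..t}"
      then consider "x = 1" | "x = 2" | "x = 3" | l where "x = 4" "T = T2222 l"
        unfolding index_set_1 by (auto split: tubular_type.splits)
      then show "Poly_Mapping.lookup (lead (sub_exponent T m)) x = Poly_Mapping.lookup n x"
      proof cases
        case (4 l)
        then show ?thesis
          using lookups(4)[OF 4(2)] ijl(5)[unfolded 4(2)] by (simp only: tubular_type.case)
      qed (simp_all only: lookups ijl)
    qed
    show "size3 m = k"
      using ijl(1) by (simp add: size3_eq m)
  qed
qed

end

section \<open>The homomorphism from R to S\<close>

context tubular
begin

text \<open>The substitution is set up between the polynomial rings, where it sends monomials to
  monomials; the two ideals are compared afterwards.\<close>

definition ev :: "'k mpoly \<Rightarrow> 'k mpoly" where
  "ev = linext (\<lambda>m. mon (sub_exponent T m))"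

lemma ev_mon: "ev (mon m) = mon (sub_exponent T m)"
  and ev_0: "ev 0 = 0"
  and ev_add: "ev (f + g) = ev f + ev g"
  and ev_diff: "ev (f - g) = ev f - ev g"
  and ev_uminus: "ev (- f) = - ev f"
  and ev_scale: "ev (Const c * f) = Const c * ev f"
  and ev_mult: "ev (f * g) = ev f * ev g"
  by (simp_all add: ev_def linext_add linext_diff linext_uminus linext_Const_mult linext_mult
      sub_exponent_add mon_add)

lemma sub_exponent_0: "sub_exponent T 0 = 0"
  by (cases T) simp_all

lemma ev_1: "ev 1 = 1"
  using ev_mon[of 0] by (simp add: sub_exponent_0)

lemma ev_power: "ev (f ^ a) = ev f ^ a"
  by (induction a) (simp_all add: ev_1 ev_mult)

lemma ev_in_poly_alg: "ev f \<in> carrier (poly_alg t)"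
  using keys_linext[of "\<lambda>m. mon (sub_exponent T m)" f] keys_sub_exponent
  by (auto simp: ev_def carrier_poly_alg)

lemma N_ev: "N (ev f) = linext (\<lambda>m. normal_mon (sub_exponent T m)) f"
  using subset_UNIV
  by (induction f rule: mpoly_induct)
    (simp_all add: ev_0 ev_mon ev_add ev_scale linext_add linext_Const_mult)

lemma ev_Var:
  "ev (Var 1) = (case T of T333 \<Rightarrow> Var 1 * Var 2 * Var 3 | T632 \<Rightarrow> Var 1 * Var 2 | _ \<Rightarrow> Var 1 * Var 2 ^ 2)"
  "ev (Var 2) = (case T of T2222 _ \<Rightarrow> Var 2 * Var 3 * Var 4 | T333 \<Rightarrow> Var 2 ^ 3 | T442 \<Rightarrow> Var 2 * Var 3 | T632 \<Rightarrow> Var 3)"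
  "ev (Var 3) = Var 1 ^ 3"
proof -
  have ev: "ev (Var i) = mon (sub_exponent T (Poly_Mapping.single i 1))" for i
    by (simp add: Var_def ev_mon)
  note simps = lookup_single Var_def mult_single mon_single_power ac_simps
  show "ev (Var 1) = (case T of T333 \<Rightarrow> Var 1 * Var 2 * Var 3 | T632 \<Rightarrow> Var 1 * Var 2 | _ \<Rightarrow> Var 1 * Var 2 ^ 2)"
    unfolding ev by (cases T) (simp_all add: simps flip: numeral_2_eq_2)
  show "ev (Var 2) = (case T of T2222 _ \<Rightarrow> Var 2 * Var 3 * Var 4 | T333 \<Rightarrow> Var 2 ^ 3 | T442 \<Rightarrow> Var 2 * Var 3 | T632 \<Rightarrow> Var 3)"
    unfolding ev by (cases T) (simp_all add: simps)
  show "ev (Var 3) = Var 1 ^ 3"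
    unfolding ev by (cases T) (simp_all add: simps)
qed

lemma relation_in_S_I: "i \<in> {3..t} \<Longrightarrow> Var i ^ w i - Q i \<in> S.I"
  using S.P.genideal_self[OF S.relations] by (auto simp: S_relations_eq)

text \<open>The image is a monomial times the relation of \<open>S\<close>, and in type (2,2,2,2) a
  combination of both relations.\<close>

lemma ev_R_relation: "ev (R_relation T) \<in> S.I"
proof -
  have ev_Const: "ev (Const c) = Const c" for c
    using ev_scale[of c 1] by (simp add: ev_1)
  note ev_simps = ev_add ev_diff ev_mult ev_power ev_Const ev_Var
  have 3: "Var 3 ^ w 3 - Q 3 \<in> S.I" and V: "Var 1 \<in> carrier (poly_alg t)" "Var 2 \<in> carrier (poly_alg t)"
    using three_le_length_weights[of T] by (auto intro: relation_in_S_I)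
  show ?thesis
  proof (cases T)
    case (T2222 l)
    \<comment> \<open>Up to the factor a^3 b^2 this is c^2 d^2 - A B = d^2 (c^2 - A) + A (d^2 - B)
      with A = b^2 - a^2 and B = b^2 - e a^2.\<close>
    have "(b * c * d)^2 * a^3 - a * b^2 * (a * b^2 - a^3) * (a * b^2 - e * a^3) =
        a^3 * b^2 * d^2 * (c^2 - (b^2 - 1 * a^2)) + a^3 * b^2 * (b^2 - 1 * a^2) * (d^2 - (b^2 - e * a^2))"
      for a b c d e :: "'k mpoly"
      by (simp add: power2_eq_square power3_eq_cube algebra_simps)
    then have "ev (R_relation T) = Var 1 ^ 3 * Var 2 ^ 2 * Var 4 ^ 2 * (Var 3 ^ w 3 - Q 3)
        + Var 1 ^ 3 * Var 2 ^ 2 * Q 3 * (Var 4 ^ w 4 - Q 4)"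
      unfolding Q_def by (simp add: T2222 ev_simps[unfolded T2222])
    moreover have "Var 4 ^ w 4 - Q 4 \<in> S.I"
      by (rule relation_in_S_I) (simp add: T2222)
    moreover have "Var 4 \<in> carrier (poly_alg t)"
      by (simp add: T2222)
    ultimately show ?thesis
      using 3 V by (simp add: S.I_add S.I_mult Q_in_poly_alg)
  next
    case T333
    have "(a * b * c)^3 - ((b^3)^2 * a^3 - (a^3)^2 * b^3) = a^3 * b^3 * (c^3 - (b^3 - 1 * a^3))"
      for a b c :: "'k mpoly"
      by (simp add: power2_eq_square power3_eq_cube algebra_simps)
    then have "ev (R_relation T) = Var 1 ^ 3 * Var 2 ^ 3 * (Var 3 ^ w 3 - Q 3)"
      unfolding Q_def by (simp add: T333 ev_simps[unfolded T333])
    then show ?thesis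
      using 3 V by (simp add: S.I_mult)
  next
    case T442
    have "(b * c)^2 * a^3 - a * b^2 * (a * b^2 - a^3) * (a * b^2 + a^3) =
        a^3 * b^2 * (c^2 - (b^4 - 1 * a^4))"
      for a b c :: "'k mpoly"
      by (simp add: power2_eq_square power3_eq_cube power4_eq_xxxx algebra_simps)
    then have "ev (R_relation T) = Var 1 ^ 3 * Var 2 ^ 2 * (Var 3 ^ w 3 - Q 3)"
      unfolding Q_def by (simp add: T442 ev_simps[unfolded T442])
    then show ?thesis
      using 3 V by (simp add: S.I_mult)
  next
    case T632
    have "a ^ 6 = a ^ 3 * a ^ 3" for a :: "'k mpoly"
      by (simp flip: power_add)
    then have "c^2 * a^3 - ((a * b)^3 - (a^3)^3) = a^3 * (c^2 - (b^3 - 1 * a^6))"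
      for a b c :: "'k mpoly"
      by (simp add: power2_eq_square power3_eq_cube algebra_simps)
    then have "ev (R_relation T) = Var 1 ^ 3 * (Var 3 ^ w 3 - Q 3)"
      unfolding Q_def by (simp add: T632 ev_simps[unfolded T632])
    then show ?thesis
      using 3 V by (simp add: S.I_mult)
  qed
qed

lemma ev_R_I:
  assumes "f \<in> R.I"
  shows "ev f \<in> S.I"
proof -
  have "N (ev f) = 0"
    using assms
  proof (rule R.I_induct_vanishing[where L = "\<lambda>f. N (ev f)", rotated 3])
    fix f e assume "e \<in> {R_relation T}"
    then show "N (ev (f * e)) = 0"
      using S.I_mult[OF ev_in_poly_alg ev_R_relation] by (simp add: ev_mult N_I)
  qed (simp_all add: ev_add ev_uminus linext_add linext_uminus)
  then show ?thesis
    by (simp add: in_S_I_iff ev_in_poly_alg)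
qed

section \<open>Injectivity, by reduction to degree at most 2 in X\<close>

abbreviation low :: "exponent set" where
  "low \<equiv> {m. Poly_Mapping.keys m \<subseteq> {1..3} \<and> Poly_Mapping.lookup m 1 \<le> 2}"

text \<open>Take \<open>m\<close> in \<open>g\<close> whose leading image has the largest degree in
  X_2. No other monomial of \<open>g\<close> contributes to that leading image: its own leading
  image is different, and its lower terms have strictly smaller degree in X_2. So the coefficient of
  \<open>m\<close> survives in \<open>N (ev g)\<close>.\<close>

lemma N_ev_eq_0:
  assumes low: "Poly_Mapping.keys g \<subseteq> low" and 0: "N (ev g) = 0"
  shows "g = 0"
proof (rule ccontr)
  assume "g \<noteq> 0"
  let ?h = "\<lambda>m. Poly_Mapping.lookup (lead (sub_exponent T m)) 2"
  have "Max (?h ` Poly_Mapping.keys g) \<in> ?h ` Poly_Mapping.keys g"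
    using \<open>g \<noteq> 0\<close> by (intro Max_in) (auto simp: poly_mapping_eq_iff fun_eq_iff in_keys_iff)
  then obtain m where m: "m \<in> Poly_Mapping.keys g" "?h m = Max (?h ` Poly_Mapping.keys g)"
    by auto
  then have max: "?h m' \<le> ?h m" if "m' \<in> Poly_Mapping.keys g" for m'
    using that by simp
  let ?c = "\<lambda>m'. Poly_Mapping.lookup (normal_mon (sub_exponent T m')) (lead (sub_exponent T m))"
  have "?c m' = (if m' = m then 1 else 0)" if m': "m' \<in> Poly_Mapping.keys g" for m'
  proof (cases "m' = m")
    case True
    then show ?thesis using triangular_lookup[OF triangular_normal_mon] by simp
  next
    case False
    let ?n = "lead (sub_exponent T m)" and ?n' = "lead (sub_exponent T m')"
    have "?n \<noteq> ?n'"
      using False lead_sub_exponent_inj[of m m'] m(1) m' low by auto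
    moreover have "?n \<notin> Poly_Mapping.keys (normal_mon (sub_exponent T m') - mon ?n')"
      using triangular_less[OF triangular_normal_mon, of ?n "sub_exponent T m'"] max[OF m'] by auto
    ultimately show ?thesis
      using False by (simp add: in_keys_iff lookup_minus lookup_single_not_eq)
  qed
  then have "(\<Sum>m'\<in>Poly_Mapping.keys g. Poly_Mapping.lookup g m' * ?c m') =
      (\<Sum>m'\<in>Poly_Mapping.keys g. Poly_Mapping.lookup g m' * (if m' = m then 1 else 0))"
    by (intro sum.cong) simp_all
  also have "\<dots> = Poly_Mapping.lookup g m"
    using m(1) by (simp add: if_distrib cong: if_cong)
  finally have "Poly_Mapping.lookup (N (ev g)) (lead (sub_exponent T m)) = Poly_Mapping.lookup g m"
    unfolding N_ev unfolding linext_def by (simp add: lookup_sum)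
  with 0 m(1) show False
    by (simp add: in_keys_iff)
qed

definition reducible :: "'k mpoly \<Rightarrow> bool" where
  "reducible f \<longleftrightarrow> (\<exists>g. Poly_Mapping.keys g \<subseteq> low \<and> f - g \<in> R.I)"

lemma reducible_0: "reducible 0"
  unfolding reducible_def by (intro exI[of _ 0]) (simp add: R.I_0)

lemma reducible_add:
  assumes "reducible f" "reducible g"
  shows "reducible (f + g)"
proof -
  obtain f' g' where *: "Poly_Mapping.keys f' \<subseteq> low" "f - f' \<in> R.I" "Poly_Mapping.keys g' \<subseteq> low" "g - g' \<in> R.I"
    using assms by (auto simp: reducible_def)
  then have "Poly_Mapping.keys (f' + g') \<subseteq> low"
    using Poly_Mapping.keys_add[of f' g'] by blast
  moreover have "f + g - (f' + g') \<in> R.I"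
    using R.I_add[OF *(2,4)] by (simp only: add_diff_add)
  ultimately show ?thesis
    unfolding reducible_def by blast
qed

lemma reducible_scale:
  assumes "reducible f"
  shows "reducible (Const c * f)"
proof -
  obtain f' where *: "Poly_Mapping.keys f' \<subseteq> low" "f - f' \<in> R.I"
    using assms by (auto simp: reducible_def)
  then have "Poly_Mapping.keys (Const c * f') \<subseteq> low"
    using keys_Const_mult[of c f'] by blast
  moreover have "Const c * f - Const c * f' \<in> R.I"
    using R.I_mult[OF poly_alg_closed(3) *(2)] by (simp only: right_diff_distrib)
  ultimately show ?thesis
    unfolding reducible_def by blast
qed

lemma cubic_rest_in_R_I: "Var 1 ^ 3 - cubic_rest T \<in> R.I"
proof -
  have "R_relation T \<in> R.I"
    using R.P.genideal_self[OF R.relations] by simp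
  then show ?thesis
    using R_relation_cases R.I_uminus[of "R_relation T"] by auto
qed

text \<open>Exchanging X^3 for \<open>cubic_rest T\<close> lowers the exponent of X in every
  resulting monomial.\<close>

lemma reducible_mon: "Poly_Mapping.keys m \<subseteq> {1..3} \<Longrightarrow> reducible (mon m)"
proof (induction "Poly_Mapping.lookup m 1" arbitrary: m rule: less_induct)
  case less
  show ?case
  proof (cases "Poly_Mapping.lookup m 1 \<le> 2")
    case True
    then show ?thesis
      unfolding reducible_def using less.prems by (intro exI[of _ "mon m"]) (simp add: R.I_0)
  next
    case False
    define m' where "m' = m - Poly_Mapping.single 1 3"
    have m: "m = Poly_Mapping.single 1 3 + m'"
      using False by (intro poly_mapping_eqI) (auto simp: m'_def lookup_add lookup_minus lookup_single when_def)
    have m': "Poly_Mapping.keys m' \<subseteq> {1..3}"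
      using less.prems by (auto simp: m'_def in_keys_iff lookup_minus)
    have "mon m - cubic_rest T * mon m' = mon m' * (Var 1 ^ 3 - cubic_rest T)"
      by (simp add: m mon_add Var_power algebra_simps)
    then have cong: "mon m - cubic_rest T * mon m' \<in> R.I"
      using R.I_mult[OF _ cubic_rest_in_R_I, of "mon m'"] m' by simp
    have "Poly_Mapping.keys (cubic_rest T * mon m') \<subseteq>
        {n. Poly_Mapping.keys n \<subseteq> {1..3} \<and> Poly_Mapping.lookup n 1 < Poly_Mapping.lookup m 1}"
    proof
      fix n assume "n \<in> Poly_Mapping.keys (cubic_rest T * mon m')"
      then obtain a where a: "n = a + m'" "a \<in> Poly_Mapping.keys (cubic_rest T)"
        using keys_mult[of "cubic_rest T" "mon m'"] by auto
      then have "Poly_Mapping.keys a \<subseteq> {1..3}" "Poly_Mapping.lookup a 1 \<le> 2"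
        using cubic_rest_keys by auto
      then show "n \<in> {n. Poly_Mapping.keys n \<subseteq> {1..3} \<and> Poly_Mapping.lookup n 1 < Poly_Mapping.lookup m 1}"
        using a(1) m' Poly_Mapping.keys_add[of a m'] by (auto simp: m lookup_add)
    qed
    then have "reducible (cubic_rest T * mon m')"
      by (induction rule: mpoly_induct) (auto simp: reducible_0 reducible_add reducible_scale less.hyps)
    then show ?thesis
      unfolding reducible_def using R.I_trans[OF cong] by blast
  qed
qed

lemma reducible: "f \<in> carrier (poly_alg 3) \<Longrightarrow> reducible f"
  unfolding carrier_poly_alg
  by (induction rule: mpoly_induct) (auto simp: reducible_0 reducible_add reducible_scale reducible_mon)

text \<open>For the forward direction \<open>f\<close> is replaced by a representative of degree at
  most 2 in X, on which \<open>N\<close> after \<open>ev\<close> has trivial kernel.\<close>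

lemma ev_in_S_I_iff:
  assumes "f \<in> carrier (poly_alg 3)"
  shows "ev f \<in> S.I \<longleftrightarrow> f \<in> R.I"
proof
  assume ev: "ev f \<in> S.I"
  obtain g where g: "Poly_Mapping.keys g \<subseteq> low" "f - g \<in> R.I"
    using reducible[OF assms] by (auto simp: reducible_def)
  have "N (ev g) = 0"
    using N_I[OF ev] N_I[OF ev_R_I[OF g(2)]] by (simp add: ev_diff linext_diff)
  with g have "g = 0"
    using N_ev_eq_0 by blast
  with g show "f \<in> R.I" by simp
qed (rule ev_R_I)

section \<open>Surjectivity onto the components with degree in H\<close>

definition spanned :: "int set \<Rightarrow> 'k mpoly \<Rightarrow> bool" where
  "spanned K f \<longleftrightarrow> (\<exists>g\<in>R.supported K. f - ev g \<in> S.I)"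

lemma spanned_0: "spanned K 0"
  unfolding spanned_def by (intro bexI[of _ 0]) (simp_all add: ev_0 S.I_0 R.supported_0)

lemma spanned_add:
  assumes "spanned K f" "spanned K g"
  shows "spanned K (f + g)"
proof -
  obtain f' g' where *: "f' \<in> R.supported K" "f - ev f' \<in> S.I" "g' \<in> R.supported K" "g - ev g' \<in> S.I"
    using assms by (auto simp: spanned_def)
  then have "f + g - ev (f' + g') \<in> S.I"
    using S.I_add[OF *(2,4)] by (simp only: ev_add add_diff_add)
  with * show ?thesis
    unfolding spanned_def using R.supported_add by blast
qed

lemma spanned_scale:
  assumes "spanned K f"
  shows "spanned K (Const c * f)"
proof -
  obtain f' where *: "f' \<in> R.supported K" "f - ev f' \<in> S.I"
    using assms by (auto simp: spanned_def)
  then have "Const c * f - ev (Const c * f') \<in> S.I"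
    using S.I_mult[OF poly_alg_closed(3) *(2)] by (simp only: ev_scale right_diff_distrib)
  with * show ?thesis
    unfolding spanned_def using R.supported_scale by blast
qed

lemma spanned_cong: "spanned K g \<Longrightarrow> f - g \<in> S.I \<Longrightarrow> spanned K f"
  unfolding spanned_def using S.I_trans by blast

abbreviation reduced :: "exponent set" where
  "reduced \<equiv> {n. Poly_Mapping.keys n \<subseteq> {1..t} \<and> (\<forall>i\<in>{3..t}. Poly_Mapping.lookup n i < w i)}"

lemma keys_normal_mon:
  assumes "Poly_Mapping.keys n \<subseteq> {1..t}" "W.H_exponent k n"
  shows "Poly_Mapping.keys (normal_mon n) \<subseteq> reduced \<inter> {m. W.H_exponent k m}"
proof -
  have "normal_mon n \<in> carrier (poly_alg t)"
    using N_cong[of "mon n"] assms by simp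
  then show ?thesis
    using assms H_exponent_normal_mon keys_normal_mon_reduced unfolding carrier_poly_alg by blast
qed

text \<open>\<open>n\<close> is the leading monomial of the normal form of some
  \<open>ev (mon m)\<close>. The other terms of this normal form are reduced, have the same
  \<open>k\<close> and a smaller exponent of X_2, so they are covered by induction.\<close>

lemma spanned_mon:
  assumes "n \<in> reduced" "W.H_exponent k n" "k \<in> K"
  shows "spanned K (mon n)"
  using assms(1,2)
proof (induction "Poly_Mapping.lookup n 2" arbitrary: n rule: less_induct)
  case less
  then obtain m where m: "Poly_Mapping.keys m \<subseteq> {1..3}" "lead (sub_exponent T m) = n" "size3 m = k"
    using ex_sub_exponent[of n k] by blast
  let ?f = "normal_mon (sub_exponent T m)"
  have "mon (sub_exponent T m) - ?f \<in> S.I"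
    using N_cong[of "mon (sub_exponent T m)"] keys_sub_exponent by simp
  then have "?f - ev (mon m) \<in> S.I"
    unfolding ev_mon by (rule S.I_sym)
  moreover have "mon m \<in> R.supported K"
    using m \<open>k \<in> K\<close> by (simp add: R.supported_def)
  ultimately have f: "spanned K ?f"
    unfolding spanned_def by blast
  have "Poly_Mapping.keys (?f - mon n) \<subseteq>
      {n'. n' \<in> reduced \<and> W.H_exponent k n' \<and> Poly_Mapping.lookup n' 2 < Poly_Mapping.lookup n 2}"
  proof
    fix n' assume n': "n' \<in> Poly_Mapping.keys (?f - mon n)"
    then have less: "Poly_Mapping.lookup n' 2 < Poly_Mapping.lookup n 2"
      using triangular_less[OF triangular_normal_mon[of "sub_exponent T m"]] m(2) by simp
    then have "n' \<noteq> n" by auto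
    with n' have "n' \<in> Poly_Mapping.keys ?f"
      by (simp add: in_keys_iff lookup_minus lookup_single_not_eq)
    with less show "n' \<in> {n'. n' \<in> reduced \<and> W.H_exponent k n' \<and> Poly_Mapping.lookup n' 2 < Poly_Mapping.lookup n 2}"
      using keys_normal_mon[OF keys_sub_exponent, of k m] H_exponent_sub_exponent[of m] m(3) by blast
  qed
  then have "spanned K (?f - mon n)"
    by (induction rule: mpoly_induct) (use less.hyps in \<open>auto simp: spanned_0 spanned_add spanned_scale\<close>)
  \<comment> \<open>The polynomial in question simplifies to \<open>mon n\<close>.\<close>
  then have "spanned K (?f + Const (- 1) * (?f - mon n))"
    using f by (intro spanned_add spanned_scale)
  then show ?case
    by (simp add: Const_uminus)
qed

lemma spanned:
  assumes "f \<in> carrier (poly_alg t)" "\<forall>n\<in>Poly_Mapping.keys f. \<exists>k\<in>K. W.H_exponent k n"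
  shows "spanned K f"
proof -
  have "Poly_Mapping.keys f \<subseteq> {n. Poly_Mapping.keys n \<subseteq> {1..t} \<and> (\<exists>k\<in>K. W.H_exponent k n)}"
    using assms unfolding carrier_poly_alg by blast
  then show ?thesis
  proof (induction rule: mpoly_induct)
    case (mon n)
    then obtain k where n: "Poly_Mapping.keys n \<subseteq> {1..t}" and k: "k \<in> K" "W.H_exponent k n"
      by blast
    have "spanned K (normal_mon n)"
      using keys_normal_mon[OF n k(2)]
      by (induction rule: mpoly_induct) (use k(1) in \<open>auto simp: spanned_0 spanned_add spanned_scale spanned_mon\<close>)
    then show ?case
      using N_cong[of "mon n"] n by (auto intro: spanned_cong)
  qed (simp_all add: spanned_0 spanned_add spanned_scale)
qed

text \<open>The set \<open>K\<close> lets one argument serve twice: \<open>UNIV\<close> yields all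
  of \<open>S_H T\<close>, and \<open>{k}\<close> yields the component of degree \<open>k\<close> of
  the push-forward.\<close>

lemma cls_H_exponent:
  "S.cls ` {f \<in> carrier (poly_alg t). \<forall>n\<in>Poly_Mapping.keys f. \<exists>k\<in>K. W.H_exponent k n} =
    (\<lambda>g. S.cls (ev g)) ` R.supported K"
proof (intro equalityI subsetI)
  fix a assume "a \<in> S.cls ` {f \<in> carrier (poly_alg t). \<forall>n\<in>Poly_Mapping.keys f. \<exists>k\<in>K. W.H_exponent k n}"
  then obtain f where f: "a = S.cls f" "f \<in> carrier (poly_alg t)" "spanned K f"
    using spanned by blast
  then obtain g where "g \<in> R.supported K" "f - ev g \<in> S.I"
    by (auto simp: spanned_def)
  with f show "a \<in> (\<lambda>g. S.cls (ev g)) ` R.supported K"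
    using S.cls_eq_iff[OF f(2) ev_in_poly_alg] by blast
next
  fix a assume "a \<in> (\<lambda>g. S.cls (ev g)) ` R.supported K"
  then obtain g where g: "a = S.cls (ev g)" "g \<in> R.supported K"
    by blast
  have "\<exists>k\<in>K. W.H_exponent k n" if "n \<in> Poly_Mapping.keys (ev g)" for n
  proof -
    from that obtain m where "m \<in> Poly_Mapping.keys g" "n = sub_exponent T m"
      using keys_linext[of "\<lambda>m. mon (sub_exponent T m)" g] by (auto simp: ev_def)
    then show ?thesis
      using g(2) H_exponent_sub_exponent[of m] unfolding R.supported_def by blast
  qed
  with g(1) show "a \<in> S.cls ` {f \<in> carrier (poly_alg t). \<forall>n\<in>Poly_Mapping.keys f. \<exists>k\<in>K. W.H_exponent k n}"
    using ev_in_poly_alg by blast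
qed

section \<open>The subalgebra generated by x, y, z\<close>

lemma elem_eq:
  "elem_x T = S.cls (ev (Var 1))" "elem_y T = S.cls (ev (Var 2))" "elem_z T = S.cls (ev (Var 3))"
proof -
  have A: "S_alg T = S.A" "S_gen T i = S.cls (Var i)" for i
    by (simp_all add: S_alg_def S_gen_def S.cls_def Let_def)
  have V: "Var 1 \<in> carrier (poly_alg t)" "Var 2 \<in> carrier (poly_alg t)" "Var 3 \<in> carrier (poly_alg t)"
    using three_le_length_weights[of T] by auto
  note simps = A S.A_power S.A_mult V poly_alg_closed poly_alg_closed_power
  have "elem_x T = S.cls (ev (Var 1)) \<and> elem_y T = S.cls (ev (Var 2))"
  proof (cases T)
    case (T2222 l)
    then have "elem_x T = S_gen T 1 \<otimes>\<^bsub>S_alg T\<^esub> S_gen T 2 [^]\<^bsub>S_alg T\<^esub> (2::nat)"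
      "elem_y T = S_gen T 2 \<otimes>\<^bsub>S_alg T\<^esub> S_gen T 3 \<otimes>\<^bsub>S_alg T\<^esub> S_gen T 4"
      "ev (Var 1) = Var 1 * Var 2 ^ 2" "ev (Var 2) = Var 2 * Var 3 * Var 4"
      "(Var 4 :: 'k mpoly) \<in> carrier (poly_alg t)"
      using ev_Var(1,2) by (simp_all add: elem_x_def elem_y_def)
    then show ?thesis by (simp only: simps simp_thms)
  next
    case T333
    then have "elem_x T = S_gen T 1 \<otimes>\<^bsub>S_alg T\<^esub> S_gen T 2 \<otimes>\<^bsub>S_alg T\<^esub> S_gen T 3"
      "elem_y T = S_gen T 2 [^]\<^bsub>S_alg T\<^esub> (3::nat)"
      "ev (Var 1) = Var 1 * Var 2 * Var 3" "ev (Var 2) = Var 2 ^ 3"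
      using ev_Var(1,2) by (simp_all add: elem_x_def elem_y_def)
    then show ?thesis by (simp only: simps simp_thms)
  next
    case T442
    then have "elem_x T = S_gen T 1 \<otimes>\<^bsub>S_alg T\<^esub> S_gen T 2 [^]\<^bsub>S_alg T\<^esub> (2::nat)"
      "elem_y T = S_gen T 2 \<otimes>\<^bsub>S_alg T\<^esub> S_gen T 3"
      "ev (Var 1) = Var 1 * Var 2 ^ 2" "ev (Var 2) = Var 2 * Var 3"
      using ev_Var(1,2) by (simp_all add: elem_x_def elem_y_def)
    then show ?thesis by (simp only: simps simp_thms)
  next
    case T632
    then have "elem_x T = S_gen T 1 \<otimes>\<^bsub>S_alg T\<^esub> S_gen T 2" "elem_y T = S_gen T 3"
      "ev (Var 1) = Var 1 * Var 2" "ev (Var 2) = Var 3"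
      using ev_Var(1,2) by (simp_all add: elem_x_def elem_y_def)
    then show ?thesis by (simp only: simps simp_thms)
  qed
  then show "elem_x T = S.cls (ev (Var 1))" "elem_y T = S.cls (ev (Var 2))"
    by blast+
  show "elem_z T = S.cls (ev (Var 3))"
    unfolding elem_z_def by (simp only: simps ev_Var)
qed

text \<open>The image \<open>?M\<close> is itself a subalgebra containing x, y, z. Conversely, a
  subalgebra with these elements contains the classes of all x^a y^b z^c and, by linearity, all of
  \<open>?M\<close>.\<close>

lemma generated_subalgebra_eq:
  "generated_subalgebra S.A {elem_x T, elem_y T, elem_z T} = (\<lambda>g. S.cls (ev g)) ` carrier (poly_alg 3)"
    (is "_ = ?M")
proof (intro equalityI subsetI)
  have "subring ?M S.A"
  proof (rule S.A.subringI)
    show "\<one>\<^bsub>S.A\<^esub> \<in> ?M"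
      unfolding S.A_one by (rule image_eqI[of _ _ 1]) (simp_all add: ev_1)
  next
    fix a assume "a \<in> ?M"
    then obtain g where "g \<in> carrier (poly_alg 3)" "a = S.cls (ev g)" by blast
    then show "\<ominus>\<^bsub>S.A\<^esub> a \<in> ?M"
      by (intro image_eqI[of _ _ "- g"]) (simp_all add: S.A_uminus ev_in_poly_alg ev_uminus)
  next
    fix a b assume "a \<in> ?M" "b \<in> ?M"
    then obtain f g where "f \<in> carrier (poly_alg 3)" "a = S.cls (ev f)" "g \<in> carrier (poly_alg 3)" "b = S.cls (ev g)"
      by blast
    then show "a \<otimes>\<^bsub>S.A\<^esub> b \<in> ?M" "a \<oplus>\<^bsub>S.A\<^esub> b \<in> ?M"
      by (intro image_eqI[of _ _ "f * g"] image_eqI[of _ _ "f + g"];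
          simp add: S.A_mult S.A_add ev_in_poly_alg ev_mult ev_add)+
  qed (auto simp: ev_in_poly_alg)
  moreover have "c \<odot>\<^bsub>S.A\<^esub> a \<in> ?M" if "a \<in> ?M" for c a
  proof -
    from that obtain g where "g \<in> carrier (poly_alg 3)" "a = S.cls (ev g)" by blast
    then show ?thesis
      by (intro image_eqI[of _ _ "Const c * g"]) (simp_all add: S.A_smult ev_in_poly_alg ev_scale)
  qed
  moreover have "{elem_x T, elem_y T, elem_z T} \<subseteq> ?M"
    unfolding elem_eq by auto
  ultimately have M: "?M \<in> {B. subring B S.A \<and> (\<forall>c. \<forall>b\<in>B. c \<odot>\<^bsub>S.A\<^esub> b \<in> B)
      \<and> {elem_x T, elem_y T, elem_z T} \<subseteq> B}"
    by (intro CollectI conjI allI ballI)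
  fix a assume "a \<in> generated_subalgebra S.A {elem_x T, elem_y T, elem_z T}"
  then show "a \<in> ?M"
    unfolding generated_subalgebra_def using M by (rule InterD)
next
  fix a assume "a \<in> ?M"
  then obtain g where g: "g \<in> carrier (poly_alg 3)" "a = S.cls (ev g)" by blast
  have "S.cls (ev g) \<in> B"
    if B: "subring B S.A" "\<forall>c. \<forall>b\<in>B. c \<odot>\<^bsub>S.A\<^esub> b \<in> B" "{elem_x T, elem_y T, elem_z T} \<subseteq> B" for B
  proof -
    note closed = subringE[OF B(1)]
    have mult: "S.cls (ev (f * g)) \<in> B" if "S.cls (ev f) \<in> B" "S.cls (ev g) \<in> B" for f g
      using closed(6)[OF that] by (simp add: S.A_mult ev_in_poly_alg ev_mult)
    have power: "S.cls (ev (f ^ a)) \<in> B" if "S.cls (ev f) \<in> B" for f a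
      using closed(3) by (induction a) (simp_all add: ev_1 S.A_one mult that)
    from g(1) show ?thesis
      unfolding carrier_poly_alg
    proof (induction rule: mpoly_induct)
      case zero
      then show ?case using closed(2) by (simp add: ev_0 S.A_zero)
    next
      case (mon m)
      have "m = Poly_Mapping.single 1 (Poly_Mapping.lookup m 1) + Poly_Mapping.single 2 (Poly_Mapping.lookup m 2)
          + Poly_Mapping.single 3 (Poly_Mapping.lookup m 3)"
      proof (rule poly_mapping_eqI)
        fix i
        have "i = 1 \<or> i = 2 \<or> i = 3 \<or> i \<notin> Poly_Mapping.keys m"
          using mon by (cases "i \<in> {1..3}") auto
        then show "Poly_Mapping.lookup m i = Poly_Mapping.lookup (Poly_Mapping.single 1 (Poly_Mapping.lookup m 1)
            + Poly_Mapping.single 2 (Poly_Mapping.lookup m 2) + Poly_Mapping.single 3 (Poly_Mapping.lookup m 3)) i"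
          by (auto simp: lookup_add lookup_single when_def in_keys_iff)
      qed
      then have m: "mon m = Var 1 ^ Poly_Mapping.lookup m 1 * Var 2 ^ Poly_Mapping.lookup m 2 * Var 3 ^ Poly_Mapping.lookup m 3"
        by (metis Var_power mon_add)
      show ?case
        unfolding m by (intro mult power) (use B(3) in \<open>simp_all add: elem_eq\<close>)
    next
      case (add f g)
      then show ?case
        using closed(7)[OF add] by (simp add: S.A_add ev_in_poly_alg ev_add)
    next
      case (scale c f)
      then show ?case
        using B(2) S.A_smult[OF ev_in_poly_alg, of c f] by (metis ev_scale)
    qed
  qed
  with g(2) show "a \<in> generated_subalgebra S.A {elem_x T, elem_y T, elem_z T}"
    unfolding generated_subalgebra_def by blast
qed

section \<open>The isomorphism of graded algebras\<close>

definition \<phi> :: "'k mpoly set \<Rightarrow> 'k mpoly set" where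
  "\<phi> a = S.cls (ev (SOME f. f \<in> carrier (poly_alg 3) \<and> a = R.cls f))"

text \<open>The chosen representative does not matter because \<open>ev\<close> maps
  \<open>R.I\<close> into \<open>S.I\<close>.\<close>

lemma \<phi>_cls:
  assumes "f \<in> carrier (poly_alg 3)"
  shows "\<phi> (R.cls f) = S.cls (ev f)"
proof -
  let ?g = "SOME g. g \<in> carrier (poly_alg 3) \<and> R.cls f = R.cls g"
  have g: "?g \<in> carrier (poly_alg 3) \<and> R.cls f = R.cls ?g"
    by (rule someI[of _ f]) (simp add: assms)
  then have "ev (?g - f) \<in> S.I"
    using R.cls_eq_iff[of ?g f] assms by (intro ev_R_I) simp
  then show ?thesis
    unfolding \<phi>_def by (simp add: S.cls_eq_iff ev_in_poly_alg ev_diff)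
qed

lemma S_H_simps:
  "\<zero>\<^bsub>S_H T\<^esub> = \<zero>\<^bsub>S.A\<^esub>" "\<one>\<^bsub>S_H T\<^esub> = \<one>\<^bsub>S.A\<^esub>" "a \<oplus>\<^bsub>S_H T\<^esub> b = a \<oplus>\<^bsub>S.A\<^esub> b" "a \<otimes>\<^bsub>S_H T\<^esub> b = a \<otimes>\<^bsub>S.A\<^esub> b"
  "c \<odot>\<^bsub>S_H T\<^esub> a = c \<odot>\<^bsub>S.A\<^esub> a" "homog (S_H T) = homog S.A"
  by (simp_all add: S_H_def restrict_grading_def S_alg_def)

lemma carrier_S_H: "carrier (S_H T) = S.cls ` S.supported (carrier (H_group (weights T)))"
proof -
  have "carrier (S_H T) = homog_sum S.A (carrier (H_group (weights T)))"
    by (simp add: S_H_def restrict_grading_def S_alg_def)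
  also have "\<dots> = S.cls ` S.supported (carrier (H_group (weights T)))"
    by (rule S.homog_sum_cls[OF S.A.abelian_monoid_axioms]) (auto simp: S.supported_def)
  finally show ?thesis .
qed

lemma abelian_monoid_S_H: "abelian_monoid (S_H T)"
proof (rule abelian_monoidI)
  show "\<zero>\<^bsub>S_H T\<^esub> \<in> carrier (S_H T)"
    unfolding carrier_S_H S_H_simps S.A_zero by (intro imageI S.supported_0)
next
  fix a b assume ab: "a \<in> carrier (S_H T)" "b \<in> carrier (S_H T)"
  then obtain f g where "f \<in> S.supported (carrier (H_group (weights T)))" "a = S.cls f"
    "g \<in> S.supported (carrier (H_group (weights T)))" "b = S.cls g"
    unfolding carrier_S_H by blast
  then show "a \<oplus>\<^bsub>S_H T\<^esub> b \<in> carrier (S_H T)"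
    unfolding carrier_S_H S_H_simps
    by (intro image_eqI[of _ _ "f + g"] S.supported_add) (auto simp: S.A_add S.supported_def)
qed (auto simp: S_H_simps carrier_S_H S.supported_def S.A.a_ac)

context
  fixes \<pi> :: "(nat \<Rightarrow>\<^sub>0 int) set \<Rightarrow> int"
  assumes \<pi>: "\<pi> \<in> hom (H_group (weights T)) integer_group"
    "\<pi> (xvec (weights T) 1 [^]\<^bsub>string_group (weights T)\<^esub> (3::nat)) = 1" "\<pi> (omega (weights T)) = 0"
begin

lemma S_H_eq: "carrier (S_H T) = (\<lambda>g. S.cls (ev g)) ` carrier (poly_alg 3)"
proof -
  have "S.supported (carrier (H_group (weights T))) =
      {f \<in> carrier (poly_alg t). \<forall>n\<in>Poly_Mapping.keys f. \<exists>k\<in>UNIV. W.H_exponent k n}"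
    unfolding S.supported_def W.string_degree_in_H[OF \<pi>] by simp
  moreover have "R.supported UNIV = carrier (poly_alg 3)"
    by (simp add: R.supported_def)
  ultimately show ?thesis
    unfolding carrier_S_H using cls_H_exponent[of UNIV] by simp
qed

lemma homog_pushforward:
  "homog (pushforward (H_group (weights T)) \<pi> (S_H T)) k = (\<lambda>g. S.cls (ev g)) ` R.supported {k}"
proof -
  let ?J = "{g \<in> carrier (H_group (weights T)). \<pi> g = k}"
  have "homog (pushforward (H_group (weights T)) \<pi> (S_H T)) k = homog_sum (S_H T) ?J"
    by (simp add: pushforward_def)
  also have "\<dots> = S.cls ` S.supported ?J"
    by (rule S.homog_sum_cls[OF abelian_monoid_S_H])
      (auto simp: S_H_simps fun_eq_iff carrier_S_H S.supported_def)
  also have "S.supported ?J = {f \<in> carrier (poly_alg t). \<forall>n\<in>Poly_Mapping.keys f. \<exists>k\<in>{k}. W.H_exponent k n}"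
    unfolding S.supported_def W.string_degree_in_fibre[OF \<pi>] by simp
  finally show ?thesis
    unfolding cls_H_exponent .
qed

text \<open>Injectivity is \<open>ev_in_S_I_iff\<close> and surjectivity is \<open>S_H_eq\<close>.
  The gradings agree because, by \<open>homog_pushforward\<close>, both components of degree
  \<open>k\<close> come from the polynomials in X, Y, Z homogeneous of degree
  \<open>k\<close>.\<close>

lemma \<phi>_graded_alg_iso: "\<phi> \<in> graded_alg_iso (R_alg T) (pushforward (H_group (weights T)) \<pi> (S_H T))"
proof -
  let ?B = "pushforward (H_group (weights T)) \<pi> (S_H T)"
  have R: "R_alg T = R.A"
    by (simp add: R_alg_def)
  have B: "carrier ?B = (\<lambda>g. S.cls (ev g)) ` carrier (poly_alg 3)" "\<one>\<^bsub>?B\<^esub> = \<one>\<^bsub>S.A\<^esub>"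
    "a \<oplus>\<^bsub>?B\<^esub> b = a \<oplus>\<^bsub>S.A\<^esub> b" "a \<otimes>\<^bsub>?B\<^esub> b = a \<otimes>\<^bsub>S.A\<^esub> b" "c \<odot>\<^bsub>?B\<^esub> a = c \<odot>\<^bsub>S.A\<^esub> a" for a b c
    by (simp_all add: pushforward_def S_H_simps flip: S_H_eq)
  have "\<phi> \<in> ring_iso R.A ?B"
  proof (rule ring_iso_memI)
    show "bij_betw \<phi> (carrier R.A) (carrier ?B)"
    proof (rule bij_betw_imageI)
      show "inj_on \<phi> (carrier R.A)"
      proof (rule inj_onI)
        fix a b assume "a \<in> carrier R.A" "b \<in> carrier R.A" and eq: "\<phi> a = \<phi> b"
        then obtain f g where fg: "f \<in> carrier (poly_alg 3)" "a = R.cls f" "g \<in> carrier (poly_alg 3)" "b = R.cls g"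
          by (auto simp: R.carrier_A)
        with eq have "ev (f - g) \<in> S.I"
          by (simp add: \<phi>_cls S.cls_eq_iff ev_in_poly_alg ev_diff)
        with fg show "a = b"
          by (simp add: ev_in_S_I_iff R.cls_eq_iff)
      qed
      show "\<phi> ` carrier R.A = carrier ?B"
        unfolding B R.carrier_A image_image by (rule image_cong) (simp_all add: \<phi>_cls)
    qed
  qed (auto simp: R.carrier_A B R.A_mult R.A_add R.A_one S.A_mult S.A_add S.A_one \<phi>_cls ev_in_poly_alg
      ev_mult ev_add ev_1)
  moreover have "\<phi> (c \<odot>\<^bsub>R.A\<^esub> a) = c \<odot>\<^bsub>?B\<^esub> \<phi> a" if "a \<in> carrier R.A" for c a
    using that by (auto simp: R.carrier_A R.A_smult B S.A_smult \<phi>_cls ev_in_poly_alg ev_scale)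
  moreover have "\<phi> ` homog R.A k = homog ?B k" for k
  proof -
    have "homog R.A k = R.cls ` R.supported {k}"
      by (simp add: R.A_homog R.supported_def)
    then show ?thesis
      unfolding homog_pushforward by (auto simp: image_image R.supported_def \<phi>_cls intro!: image_cong)
  qed
  ultimately show ?thesis
    unfolding graded_alg_iso_def R by blast
qed

end

end

theorem theorem7p4:
  fixes T :: "'k::field tubular_type"
    and \<pi> :: "(nat \<Rightarrow>\<^sub>0 int) set \<Rightarrow> int"
  assumes "admissible T"
    and "\<pi> \<in> hom (H_group (weights T)) integer_group"
    and "\<pi> (xvec (weights T) 1 [^]\<^bsub>string_group (weights T)\<^esub> (3::nat)) = 1"
    and "\<pi> (omega (weights T)) = 0"
  shows "generated_subalgebra (S_alg T) {elem_x T, elem_y T, elem_z T} = carrier (S_H T)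
    \<and> graded_alg_iso (R_alg T) (pushforward (H_group (weights T)) \<pi> (S_H T)) \<noteq> {}"
proof -
  interpret tubular T .
  show ?thesis
    using generated_subalgebra_eq S_H_eq[OF assms(2-4)] \<phi>_graded_alg_iso[OF assms(2-4)]
    by (auto simp: S_alg_def)
qed

end
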